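(* Let $\hat{A}\in\mathbb{DC}^{n\times n}$ with $t=\operatorname{Rank}(\hat{A})$ and $r=\operatorname{ARank}(\hat A)$. Then there exists $\hat{U}\in\mathbb{DC}_n^{U}$ such that $$\hat{A}=\hat{U}\begin{bmatrix}\Sigma_0K_0&\Sigma_0L_0\\0&0\end{bmatrix}\hat{U}^*,$$ where $K_0\in\mathbb{DC}^{t\times t}$ and $L_0\in\mathbb{DC}^{t\times(n-t)}$ satisfy $K_0K_0^*+L_0L_0^*=I_t$, and $$\Sigma_0=\operatorname{diag}(\mu_1,\ldots,\mu_r,\mu_{r+1},\ldots,\mu_t)$$ with $\mu_1\ge\mu_2\ge\cdots\ge\mu_r$ positive appreciable dual numbers and $\mu_{r+1}\ge\mu_{r+2}\ge\cdots\ge\mu_t$ positive infinitesimal dual numbers.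
   Context: Dual complex numbers are $\hat a=a_s+\epsilon a_d$ with $a_s,a_d\in\mathbb{C}$, $\epsilon\ne0$, $\epsilon^2=0$, $\epsilon$ commuting with scalars; they form the ring $\mathbb{DC}$. A dual number is such an element with $a_s,a_d\in\mathbb{R}$. It is appreciable if $a_s\neq0$ and infinitesimal if $a_s=0$. Dual numbers are totally ordered by: $\hat a\le\hat b$ iff $a_s<b_s$, or $a_s=b_s$ and $a_d\le b_d$; $\hat a$ is positive if $\hat a>0$. A matrix $\hat A\in\mathbb{DC}^{m\times n}$ is written $\hat A=A_s+\epsilon A_d$ with $A_s,A_d\in\mathbb{C}^{m\times n}$; $\hat A^*=A_s^*+\epsilon A_d^*$. $\mathbb{DC}_n^U$ is the set of $\hat U\in\mathbb{DC}^{n\times n}$ with $\hat U^{-1}=\hat U^*$. Dual SVD: every $\hat A\in\mathbb{DC}^{m\times n}$ can be written $\hat A=\hat P\begin{bmatrix}\Sigma_0&0\\0&0\end{bmatrix}\hat V^*$ with $\hat P\in\mathbb{DC}_m^U$, $\hat V\in\mathbb{DC}_n^U$, $\Sigma_0=\operatorname{diag}(\mu_1,\ldots,\mu_t)$, $\mu_1\ge\dots\ge\mu_r$ positive appreciable and $\mu_{r+1}\ge\dots\ge\mu_t$ positive infinitesimal dual numbers, where $\Sigma_0$ is uniquely determined by $\hat A$. Then $\operatorname{Rank}(\hat A)=t$ and $\operatorname{ARank}(\hat A)=r=\operatorname{rank}(A_s)$. *)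

theory Defs
  imports "Jordan_Normal_Form.Matrix" "Jordan_Normal_Form.Conjugate"
begin

section \<open>Dual numbers\<close>

text \<open>\<open>Dual a b\<close> is \<open>a + \<epsilon> b\<close> with \<open>\<epsilon>\<^sup>2 = 0\<close>; see \<open>Dual_eq\<close> below.\<close>

datatype 'a dual_number = Dual (std_part: 'a) (inf_part: 'a)

type_synonym dual_real = "real dual_number"
type_synonym dual_complex = "complex dual_number"

instantiation dual_number :: (comm_ring_1) comm_ring_1
begin

definition "0 = Dual 0 0"
definition "1 = Dual 1 0"
definition "x + y = Dual (std_part x + std_part y) (inf_part x + inf_part y)"
definition "- x = Dual (- std_part x) (- inf_part x)"
definition "x - y = Dual (std_part x - std_part y) (inf_part x - inf_part y)"
definition "x * y =
  Dual (std_part x * std_part y) (std_part x * inf_part y + inf_part x * std_part y)"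

instance
  by intro_classes
    (auto simp: zero_dual_number_def one_dual_number_def plus_dual_number_def
      uminus_dual_number_def minus_dual_number_def times_dual_number_def algebra_simps)

end

definition dual_eps :: "'a :: comm_ring_1 dual_number" where
  "dual_eps = Dual 0 1"

lemma dual_eps_nonzero: "dual_eps \<noteq> 0"
  by (simp add: dual_eps_def zero_dual_number_def)

lemma dual_eps_square: "dual_eps * dual_eps = 0"
  by (simp add: dual_eps_def zero_dual_number_def times_dual_number_def)

lemma Dual_eq: "Dual a b = Dual a 0 + dual_eps * Dual b 0"
  by (simp add: dual_eps_def plus_dual_number_def times_dual_number_def)

instantiation dual_number :: (linorder) linorder
begin

definition "x \<le> y \<longleftrightarrow>
  std_part x < std_part y \<or> std_part x = std_part y \<and> inf_part x \<le> inf_part y"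
definition "x < y \<longleftrightarrow>
  std_part x < std_part y \<or> std_part x = std_part y \<and> inf_part x < inf_part y"

instance
  by intro_classes
    (auto simp: less_eq_dual_number_def less_dual_number_def intro: dual_number.expand)

end

text \<open>The conjugate leaves \<open>\<epsilon>\<close> fixed.\<close>

instantiation dual_number :: ("{comm_ring_1, conjugatable_ring}") conjugatable_ring
begin

definition "conjugate x = Dual (conjugate (std_part x)) (conjugate (inf_part x))"

instance
  by intro_classes
    (auto simp: conjugate_dual_number_def zero_dual_number_def plus_dual_number_def
      uminus_dual_number_def times_dual_number_def conjugate_dist_mul conjugate_dist_add
      conjugate_neg intro: dual_number.expand)

end

definition appreciable :: "'a :: zero dual_number \<Rightarrow> bool" where
  "appreciable x \<longleftrightarrow> std_part x \<noteq> 0"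

definition infinitesimal :: "'a :: zero dual_number \<Rightarrow> bool" where
  "infinitesimal x \<longleftrightarrow> std_part x = 0"

text \<open>Dual numbers (with real parts) as dual complex numbers.\<close>

definition dual_complex_of_real :: "dual_real \<Rightarrow> dual_complex" where
  "dual_complex_of_real = map_dual_number complex_of_real"


section \<open>Dual complex matrices\<close>

text \<open>The library's \<open>mat_adjoint\<close> requires entries from a field, which dual numbers are not.\<close>

definition adjoint :: "'a :: conjugate mat \<Rightarrow> 'a mat" where
  "adjoint A = mat (dim_col A) (dim_row A) (\<lambda>(i, j). conjugate (A $$ (j, i)))"

lemma adjoint_parts:
  "map_mat std_part (adjoint A) = adjoint (map_mat std_part A)"
  "map_mat inf_part (adjoint A) = adjoint (map_mat inf_part A)"
  by (auto simp: adjoint_def conjugate_dual_number_def intro!: eq_matI)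

definition dual_unitary :: "nat \<Rightarrow> dual_complex mat \<Rightarrow> bool" where
  "dual_unitary n U \<longleftrightarrow>
     U \<in> carrier_mat n n \<and> inverts_mat U (adjoint U) \<and> inverts_mat (adjoint U) U"

text \<open>Indices start at 0: the appreciable values are \<open>\<mu> 0, \<dots>, \<mu> (r - 1)\<close>, the infinitesimal
  ones \<open>\<mu> r, \<dots>, \<mu> (t - 1)\<close>.\<close>

definition dual_singular_values :: "nat \<Rightarrow> nat \<Rightarrow> (nat \<Rightarrow> dual_real) \<Rightarrow> bool" where
  "dual_singular_values r t \<mu> \<longleftrightarrow>
     r \<le> t \<and>
     (\<forall>i. i < r \<longrightarrow> appreciable (\<mu> i) \<and> \<mu> i > 0) \<and>
     (\<forall>i. r \<le> i \<and> i < t \<longrightarrow> infinitesimal (\<mu> i) \<and> \<mu> i > 0) \<and>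
     (\<forall>i j. i \<le> j \<and> j < r \<longrightarrow> \<mu> i \<ge> \<mu> j) \<and>
     (\<forall>i j. r \<le> i \<and> i \<le> j \<and> j < t \<longrightarrow> \<mu> i \<ge> \<mu> j)"

definition dual_diag :: "nat \<Rightarrow> (nat \<Rightarrow> dual_real) \<Rightarrow> dual_complex mat" where
  "dual_diag t \<mu> = mat_diag t (\<lambda>i. dual_complex_of_real (\<mu> i))"

definition dual_svd ::
  "dual_complex mat \<Rightarrow> dual_complex mat \<Rightarrow> nat \<Rightarrow> nat \<Rightarrow> (nat \<Rightarrow> dual_real) \<Rightarrow>
    dual_complex mat \<Rightarrow> bool" where
  "dual_svd A P r t \<mu> V \<longleftrightarrow>
     (let m = dim_row A; n = dim_col A in
        t \<le> m \<and> t \<le> n \<and> dual_unitary m P \<and> dual_unitary n V \<and>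
        dual_singular_values r t \<mu> \<and>
        A = P * four_block_mat (dual_diag t \<mu>) (0\<^sub>m t (n - t))
                               (0\<^sub>m (m - t) t) (0\<^sub>m (m - t) (n - t)) * adjoint V)"

text \<open>Both descriptions are definite because a dual SVD always exists and its singular values
  are uniquely determined by the matrix.\<close>

definition dual_rank :: "dual_complex mat \<Rightarrow> nat" where
  "dual_rank A = (THE t. \<exists>P r \<mu> V. dual_svd A P r t \<mu> V)"

definition appreciable_rank :: "dual_complex mat \<Rightarrow> nat" where
  "appreciable_rank A = (THE r. \<exists>P t \<mu> V. dual_svd A P r t \<mu> V)"

end

theory Submission
  imports Defs "Jordan_Normal_Form.Spectral_Radius" "HOL-Combinatorics.Permutations"
begin

text \<open>If \<open>A = P \<Sigma> V\<^sup>*\<close> is a dual SVD, then \<open>U = P\<close> works, with \<open>[K\<^sub>0 L\<^sub>0]\<close> the first \<open>t\<close> rows of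
  the unitary matrix \<open>V\<^sup>* P\<close>. The SVD exists because every nonempty square matrix has a
  singular pair \<open>A v = \<sigma> u\<close>, \<open>A\<^sup>* u = \<sigma> v\<close> of unit vectors, which can be split off by
  unitary transformations. Over the complex numbers the pair comes from an eigenvector of
  \<open>A\<^sup>* A\<close>; over the dual numbers it is a first-order perturbation of a complex pair. The ranks
  are determined by \<open>A\<close> since the number of zeros on the diagonal of \<open>\<Sigma>\<close>, respectively of
  \<open>\<epsilon> \<Sigma>\<close>, is the dimension of a space of standard parts of vectors annihilated by \<open>A\<close>,
  respectively by \<open>\<epsilon> A\<close>.\<close>

section \<open>Unitary matrices and deflation\<close>

text \<open>The dual numbers have zero divisors, so existence is reduced to complex matrices. The
  induction that splits off pairs rests on two properties of the ring: a unit column is the first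
  column of a unitary matrix, and a singular pair exists. It is therefore proved once, over
  commutative rings with conjugation, and applied to both number systems. The obstacle is a multiple
  singular value of the standard part: there the first-order equations for a pair are singular, and
  only special vectors can be perturbed. They are eigenvectors of a Hermitian matrix, which the
  complex SVD supplies. No pair has to be extremal; sorting comes last. For the ranks,
  \<open>a * y = 0\<close> with \<open>a\<close> nonzero forces only the standard part of
  \<open>y\<close> to vanish. This is why standard parts of vectors are counted.\<close>

lemma conjugate_one [simp]: "conjugate (1 :: 'a :: {comm_ring_1, conjugatable_ring}) = 1"
proof -
  have "1 = conjugate (conjugate 1 * (1::'a))" by simp
  also have "\<dots> = conjugate 1"
    by (simp only: conjugate_dist_mul conjugate_id mult_1_left)
  finally show ?thesis by (rule sym)
qed

lemma adjoint_carrier [simp]: "adjoint A \<in> carrier_mat m n \<longleftrightarrow> A \<in> carrier_mat n m"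
  unfolding adjoint_def carrier_mat_def by auto

lemma adjoint_index [simp]:
  "i < dim_col A \<Longrightarrow> j < dim_row A \<Longrightarrow> adjoint A $$ (i, j) = conjugate (A $$ (j, i))"
  "dim_row (adjoint A) = dim_col A" "dim_col (adjoint A) = dim_row A"
  by (auto simp: adjoint_def)

lemma adjoint_adjoint [simp]: "adjoint (adjoint A) = A"
  by (rule eq_matI) auto

lemma adjoint_one [simp]:
  "adjoint (1\<^sub>m n :: 'a :: {comm_ring_1, conjugatable_ring} mat) = 1\<^sub>m n"
  by (rule eq_matI) auto

lemma adjoint_zero [simp]:
  "adjoint (0\<^sub>m n m :: 'a :: {comm_ring_1, conjugatable_ring} mat) = 0\<^sub>m m n"
  by (rule eq_matI) auto

lemma adjoint_mult:
  fixes A B :: "'a :: {comm_ring_1, conjugatable_ring} mat"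
  assumes "A \<in> carrier_mat n m" "B \<in> carrier_mat m k"
  shows "adjoint (A * B) = adjoint B * adjoint A"
  using assms
  by (intro eq_matI)
    (auto simp: scalar_prod_def sum_conjugate conjugate_dist_mul mult.commute intro!: sum.cong)

lemma adjoint_smult:
  fixes A :: "'a :: {comm_ring_1, conjugatable_ring} mat"
  shows "adjoint (c \<cdot>\<^sub>m A) = conjugate c \<cdot>\<^sub>m adjoint A"
  by (intro eq_matI) (auto simp: conjugate_dist_mul)

lemma adjoint_four_block_mat:
  assumes "A \<in> carrier_mat n m" "B \<in> carrier_mat n k" "C \<in> carrier_mat l m" "D \<in> carrier_mat l k"
  shows "adjoint (four_block_mat A B C D)
    = four_block_mat (adjoint A) (adjoint C) (adjoint B) (adjoint D)"
  using assms by (intro eq_matI) auto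

definition unitary_mat :: "nat \<Rightarrow> 'a :: {comm_ring_1, conjugatable_ring} mat \<Rightarrow> bool" where
  "unitary_mat n U \<longleftrightarrow>
     U \<in> carrier_mat n n \<and> U * adjoint U = 1\<^sub>m n \<and> adjoint U * U = 1\<^sub>m n"

lemma dual_unitary_iff: "dual_unitary n U \<longleftrightarrow> unitary_mat n U"
  by (auto simp: dual_unitary_def unitary_mat_def inverts_mat_def)

lemma unitary_matD:
  assumes "unitary_mat n U"
  shows "U \<in> carrier_mat n n" "adjoint U \<in> carrier_mat n n"
    "U * adjoint U = 1\<^sub>m n" "adjoint U * U = 1\<^sub>m n"
  using assms by (auto simp: unitary_mat_def)

lemma unitary_mat_one [simp]: "unitary_mat n (1\<^sub>m n)"
  by (simp add: unitary_mat_def)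

lemma unitary_mat_adjoint: "unitary_mat n U \<Longrightarrow> unitary_mat n (adjoint U)"
  by (auto simp: unitary_mat_def)

lemma unitary_mat_cancel:
  assumes "unitary_mat n U" "A \<in> carrier_mat n m"
  shows "adjoint U * (U * A) = A" "U * (adjoint U * A) = A"
  using assms by (auto simp: unitary_mat_def simp flip: assoc_mult_mat[of _ n n _ n _ m])

lemma unitary_mat_mult:
  assumes U: "unitary_mat n U" and V: "unitary_mat n V"
  shows "unitary_mat n (U * V)"
proof -
  note c = unitary_matD(1,2)[OF U] unitary_matD(1,2)[OF V]
  have a: "adjoint (U * V) = adjoint V * adjoint U" using c by (intro adjoint_mult) auto
  have "U * V * (adjoint V * adjoint U) = U * (V * (adjoint V * adjoint U))"
    using c by (simp add: assoc_mult_mat[of _ n n _ n _ n])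
  moreover have "adjoint V * adjoint U * (U * V) = adjoint V * (adjoint U * (U * V))"
    using c by (simp add: assoc_mult_mat[of _ n n _ n _ n])
  ultimately show ?thesis
    using c unitary_mat_cancel[OF V c(2)] unitary_mat_cancel[OF U c(3)] unitary_matD(3,4)[OF U]
      unitary_matD(3,4)[OF V]
    by (auto simp: unitary_mat_def a)
qed

lemma unitary_mat_block_one:
  assumes U: "unitary_mat n U"
  shows "unitary_mat (Suc n) (four_block_mat (1\<^sub>m 1) (0\<^sub>m 1 n) (0\<^sub>m n 1) U)"
proof -
  note c = unitary_matD[OF U]
  have a: "adjoint (four_block_mat (1\<^sub>m 1) (0\<^sub>m 1 n) (0\<^sub>m n 1) U)
    = four_block_mat (1\<^sub>m 1) (0\<^sub>m 1 n) (0\<^sub>m n 1) (adjoint U)"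
    using c by (subst adjoint_four_block_mat) auto
  show ?thesis
    unfolding unitary_mat_def a using c
    by (auto simp: mult_four_block_mat[of _ 1 1 _ n _ n _ _ 1 _ n] 
        four_block_one_mat[of 1 n, simplified])
qed

section \<open>Singular pairs and how they split off\<close>

definition unit_col :: "nat \<Rightarrow> 'a :: {comm_ring_1, conjugatable_ring} mat \<Rightarrow> bool" where
  "unit_col n u \<longleftrightarrow> u \<in> carrier_mat n 1 \<and> adjoint u * u = 1\<^sub>m 1"

text \<open>Vectors are one-column matrices, so that \<open>adjoint\<close> and the associativity of
  matrix products cover inner products too.\<close>

definition singular_pair ::
  "nat \<Rightarrow> 'a :: {comm_ring_1, conjugatable_ring} mat \<Rightarrow> 'a \<Rightarrow> 'a mat \<Rightarrow> 'a mat \<Rightarrow> bool" where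
  "singular_pair n A \<sigma> u v \<longleftrightarrow> unit_col n u \<and> unit_col n v \<and>
     A * v = \<sigma> \<cdot>\<^sub>m u \<and> adjoint A * u = \<sigma> \<cdot>\<^sub>m v"

lemma unit_col_mult:
  assumes U: "unitary_mat n U" and u: "unit_col n u"
  shows "unit_col n (U * u)"
proof -
  note c = unitary_matD(1,2)[OF U]
  have uc: "u \<in> carrier_mat n 1" using u by (simp add: unit_col_def)
  have "adjoint (U * u) * (U * u) = adjoint u * adjoint U * (U * u)"
    using c uc by (subst adjoint_mult[of U n n u 1]) auto
  also have "\<dots> = adjoint u * (adjoint U * (U * u))"
    using c uc by (intro assoc_mult_mat) auto
  also have "\<dots> = 1\<^sub>m 1" using u unitary_mat_cancel[OF U uc] by (simp add: unit_col_def)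
  finally show ?thesis using c uc by (simp add: unit_col_def)
qed

lemma singular_pair_unitary:
  assumes U: "unitary_mat n U" and V: "unitary_mat n V" and A: "A \<in> carrier_mat n n"
    and p: "singular_pair n A \<sigma> u v"
  shows "singular_pair n (U * A * adjoint V) \<sigma> (U * u) (V * v)"
proof -
  note c = unitary_matD(1,2)[OF U] unitary_matD(1,2)[OF V]
  have uv: "u \<in> carrier_mat n 1" "v \<in> carrier_mat n 1"
    using p by (auto simp: singular_pair_def unit_col_def)
  have "U * A * adjoint V * (V * v) = U * (A * (adjoint V * (V * v)))"
    using c uv A by (simp add: assoc_mult_mat[of _ n n _ n _ n] assoc_mult_mat[of _ n n _ n _ 1])
  also have "\<dots> = \<sigma> \<cdot>\<^sub>m (U * u)"
    using p c uv by (simp add: unitary_mat_cancel(1)[OF V uv(2)] singular_pair_def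
      mult_smult_distrib[of _ n n _ 1])
  finally have 1: "U * A * adjoint V * (V * v) = \<sigma> \<cdot>\<^sub>m (U * u)" .
  have "adjoint (U * A * adjoint V) = V * (adjoint A * adjoint U)"
    using c A by (simp add: adjoint_mult[of _ n n _ n])
  hence "adjoint (U * A * adjoint V) * (U * u) = V * (adjoint A * (adjoint U * (U * u)))"
    using c uv A by (simp add: assoc_mult_mat[of _ n n _ n _ n] assoc_mult_mat[of _ n n _ n _ 1])
  also have "\<dots> = \<sigma> \<cdot>\<^sub>m (V * v)"
    using p c uv by (simp add: unitary_mat_cancel(1)[OF U uv(1)] singular_pair_def
      mult_smult_distrib[of _ n n _ 1])
  finally show ?thesis
    using 1 p unit_col_mult[OF U, of u] unit_col_mult[OF V, of v] by (simp add: singular_pair_def)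
qed

definition basis_col :: "nat \<Rightarrow> nat \<Rightarrow> 'a :: {comm_ring_1, conjugatable_ring} mat" where
  "basis_col n k = mat n 1 (\<lambda>(i, j). if i = k then 1 else 0)"

lemma basis_col_carrier [simp]: "basis_col n k \<in> carrier_mat n 1"
  "dim_row (basis_col n k) = n" "dim_col (basis_col n k) = 1"
  by (auto simp: basis_col_def)

lemma mult_basis_col:
  fixes A :: "'a :: {comm_ring_1, conjugatable_ring} mat"
  assumes "A \<in> carrier_mat n m" "k < m" "i < n"
  shows "(A * basis_col m k) $$ (i, 0) = A $$ (i, k)"
  using assms by (auto simp: basis_col_def scalar_prod_def if_distrib cong: if_cong)

lemma unit_col_basis: "k < n \<Longrightarrow> unit_col n (basis_col n k)"
  by (auto simp: unit_col_def basis_col_def scalar_prod_def if_distrib cong: if_cong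
      intro!: eq_matI)

lemma adjoint_mat_diag:
  "adjoint (mat_diag n d :: 'a :: {comm_ring_1, conjugatable_ring} mat)
    = mat_diag n (\<lambda>i. conjugate (d i))"
  by (auto simp: mat_diag_def intro!: eq_matI)

lemma singular_pair_mat_diag:
  assumes "k < n" "conjugate (d k) = d k"
  shows "singular_pair n (mat_diag n d) (d k) (basis_col n k) (basis_col n k)"
  using assms unit_col_basis[OF assms(1)]
  by (auto simp: singular_pair_def adjoint_mat_diag mat_diag_mult_left[of _ n 1] basis_col_def
      intro!: eq_matI)

text \<open>The equation for \<open>A\<close> fixes the first column, the one for
  \<open>adjoint A\<close> the conjugate of the first row; a self-conjugate \<sigma> makes both
  agree in the corner.\<close>

lemma singular_pair_block:
  assumes A: "A \<in> carrier_mat (Suc n) (Suc n)"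
    and p: "singular_pair (Suc n) A \<sigma> (basis_col (Suc n) 0) (basis_col (Suc n) 0)"
    and real: "conjugate \<sigma> = \<sigma>"
  shows "\<exists>A' \<in> carrier_mat n n. A = four_block_mat (\<sigma> \<cdot>\<^sub>m 1\<^sub>m 1) (0\<^sub>m 1 n) (0\<^sub>m n 1) A'"
proof -
  let ?A' = "mat n n (\<lambda>(i, j). A $$ (Suc i, Suc j))"
  have col: "A $$ (i, 0) = (if i = 0 then \<sigma> else 0)" if "i < Suc n" for i
    using mult_basis_col[OF A zero_less_Suc that] p that by (auto simp: singular_pair_def basis_col_def)
  have row: "A $$ (0, i) = (if i = 0 then \<sigma> else 0)" if "i < Suc n" for i
  proof -
    have "conjugate (A $$ (0, i)) = (adjoint A * basis_col (Suc n) 0) $$ (i, 0)"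
      using A that by (subst mult_basis_col[of _ "Suc n"]) auto
    also have "\<dots> = conjugate (if i = 0 then \<sigma> else 0)"
      using p that real by (auto simp: singular_pair_def basis_col_def)
    finally show ?thesis by simp
  qed
  have "A = four_block_mat (\<sigma> \<cdot>\<^sub>m 1\<^sub>m 1) (0\<^sub>m 1 n) (0\<^sub>m n 1) ?A'"
    using A col row by (intro eq_matI) auto
  thus ?thesis by (intro bexI[of _ ?A']) auto
qed

text \<open>Induction on the size. \<open>Q\<close> stands for the kind of diagonal entry wanted:
  nonnegative reals in the complex case, embedded nonnegative dual numbers in the dual case.\<close>

lemma unitary_diagonalization:
  fixes A :: "'a :: {comm_ring_1, conjugatable_ring} mat"
  assumes completion: "\<And>n (u :: 'a mat). unit_col (Suc n) u \<Longrightarrow>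
      \<exists>U. unitary_mat (Suc n) U \<and> U * basis_col (Suc n) 0 = u"
    and pair: "\<And>n (A :: 'a mat). A \<in> carrier_mat (Suc n) (Suc n) \<Longrightarrow>
      \<exists>\<sigma> u v. Q \<sigma> \<and> singular_pair (Suc n) A \<sigma> u v"
    and real: "\<And>\<sigma>. Q \<sigma> \<Longrightarrow> conjugate \<sigma> = \<sigma>"
    and A: "A \<in> carrier_mat n n"
  shows "\<exists>P V d. unitary_mat n P \<and> unitary_mat n V \<and> (\<forall>i<n. Q (d i)) \<and>
    A = P * mat_diag n d * adjoint V"
  using A
proof (induction n arbitrary: A)
  case 0
  thus ?case by (intro exI[of _ "1\<^sub>m 0"] exI[of _ "\<lambda>_. 0"]) auto
next
  case (Suc n)
  let ?n = "Suc n"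
  let ?F = "\<lambda>X Y :: 'a mat. four_block_mat X (0\<^sub>m 1 n) (0\<^sub>m n 1) Y"
  from pair[OF Suc.prems] obtain \<sigma> u v where \<sigma>: "Q \<sigma>" and p: "singular_pair ?n A \<sigma> u v" by blast
  from completion[of n u] p obtain U where U: "unitary_mat ?n U" and Uu: "U * basis_col ?n 0 = u"
    by (auto simp: singular_pair_def)
  from completion[of n v] p obtain V where V: "unitary_mat ?n V" and Vv: "V * basis_col ?n 0 = v"
    by (auto simp: singular_pair_def)
  note c = unitary_matD(1,2)[OF U] unitary_matD(1,2)[OF V] Suc.prems
  let ?M = "adjoint U * A * V"
  have M: "?M \<in> carrier_mat ?n ?n" using c by auto
  \<comment> \<open>In the new coordinates both vectors of the pair are the first basis vector, so
    the block form applies to \<open>?M\<close>.\<close>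
  have "adjoint U * u = basis_col ?n 0" "adjoint V * v = basis_col ?n 0"
    using unitary_mat_cancel(1)[OF U basis_col_carrier(1)]
      unitary_mat_cancel(1)[OF V basis_col_carrier(1)] Uu Vv by auto
  with singular_pair_unitary[OF unitary_mat_adjoint[OF U] unitary_mat_adjoint[OF V] Suc.prems p]
  have "singular_pair ?n ?M \<sigma> (basis_col ?n 0) (basis_col ?n 0)" by simp
  from singular_pair_block[OF M this real[OF \<sigma>]] obtain A' where A': "A' \<in> carrier_mat n n"
    and MA': "?M = ?F (\<sigma> \<cdot>\<^sub>m 1\<^sub>m 1) A'" by auto
  from Suc.IH[OF A'] obtain P' V' d where P': "unitary_mat n P'" and V': "unitary_mat n V'"
    and d: "\<forall>i<n. Q (d i)" and eq: "A' = P' * mat_diag n d * adjoint V'" by blast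
  \<comment> \<open>The split-off value goes to index 0 and the values of the smaller block move up
    by one.\<close>
  define d' where "d' = case_nat \<sigma> d"
  have D: "?F (\<sigma> \<cdot>\<^sub>m 1\<^sub>m 1) (mat_diag n d) = mat_diag ?n d'"
    by (rule eq_matI) (auto simp: mat_diag_def d'_def split: nat.splits)
  let ?P = "?F (1\<^sub>m 1) P'" and ?V = "?F (1\<^sub>m 1) V'"
  note c' = unitary_matD(1,2)[OF P'] unitary_matD(1,2)[OF V']
  have PD: "P' * mat_diag n d \<in> carrier_mat n n"
    using c'(1) mat_diag_dim by (rule mult_carrier_mat)
  have "?F (1\<^sub>m 1) P' * ?F (\<sigma> \<cdot>\<^sub>m 1\<^sub>m 1) (mat_diag n d) = ?F (\<sigma> \<cdot>\<^sub>m 1\<^sub>m 1) (P' * mat_diag n d)"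
    using c' left_mult_zero_mat[OF mat_diag_dim, of 1 n d]
    by (subst mult_four_block_mat[of _ 1 1 _ n _ n _ _ 1 _ n]) auto
  moreover have "\<dots> * ?F (1\<^sub>m 1) (adjoint V') = ?F (\<sigma> \<cdot>\<^sub>m 1\<^sub>m 1) A'"
    using c' left_add_zero_mat[OF A'] right_mult_zero_mat[OF PD, of 1] PD
    by (subst mult_four_block_mat[of _ 1 1 _ n _ n _ _ 1 _ n]) (auto simp: eq)
  moreover have "adjoint ?V = ?F (1\<^sub>m 1) (adjoint V')"
    using c' by (subst adjoint_four_block_mat) auto
  ultimately have "?M = ?P * mat_diag ?n d' * adjoint ?V"
    by (simp only: MA' D[symmetric])
  note PU = unitary_mat_block_one[OF P'] and VU = unitary_mat_block_one[OF V']
  note c'' = unitary_matD(1,2)[OF PU] unitary_matD(1,2)[OF VU]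
  have "A = U * (adjoint U * (A * (V * adjoint V)))"
    using c unitary_mat_cancel(2)[OF U c(5)] unitary_matD(3)[OF V] by simp
  also have "\<dots> = U * ?M * adjoint V"
    using c by (simp add: assoc_mult_mat[of _ ?n ?n _ ?n _ ?n])
  also have "\<dots> = (U * ?P) * mat_diag ?n d' * (adjoint ?V * adjoint V)"
    unfolding \<open>?M = ?P * mat_diag ?n d' * adjoint ?V\<close> using c c'' mat_diag_dim[of ?n d']
    by (simp only: assoc_mult_mat[of _ ?n ?n _ ?n _ ?n] mult_carrier_mat[of _ ?n ?n _ ?n])
  also have "adjoint ?V * adjoint V = adjoint (V * ?V)"
    using c c'' by (intro adjoint_mult[symmetric]) auto
  finally have "A = U * ?P * mat_diag ?n d' * adjoint (V * ?V)" .
  moreover have "\<forall>i<?n. Q (d' i)" using d \<sigma> by (auto simp: d'_def split: nat.splits)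
  ultimately show ?case using unitary_mat_mult[OF U PU] unitary_mat_mult[OF V VU] by blast
qed

section \<open>Complex matrices\<close>

lemma unitary_mat_smult:
  fixes U :: "'a :: {comm_ring_1, conjugatable_ring} mat"
  assumes U: "unitary_mat n U" and c: "c * conjugate c = 1"
  shows "unitary_mat n (c \<cdot>\<^sub>m U)"
proof -
  note u = unitary_matD[OF U]
  have "c \<cdot>\<^sub>m U * adjoint (c \<cdot>\<^sub>m U) = (c * conjugate c) \<cdot>\<^sub>m (U * adjoint U)"
    "adjoint (c \<cdot>\<^sub>m U) * (c \<cdot>\<^sub>m U) = (conjugate c * c) \<cdot>\<^sub>m (adjoint U * U)"
    using u(1,2) by (auto simp: adjoint_smult mult_smult_distrib[of _ n n _ n]
      mult_smult_assoc_mat[of _ n n _ n] mult.assoc intro!: eq_matI)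
  moreover have "1 \<cdot>\<^sub>m 1\<^sub>m n = (1\<^sub>m n :: 'a mat)" by (intro eq_matI) auto
  ultimately show ?thesis using u c by (simp add: unitary_mat_def mult.commute[of "conjugate c"])
qed

lemma unit_col_iff:
  "unit_col n u \<longleftrightarrow>
    u \<in> carrier_mat n 1 \<and> (\<Sum>i<n. conjugate (u $$ (i, 0)) * u $$ (i, 0)) = 1"
proof (cases "u \<in> carrier_mat n 1")
  case True
  hence "(adjoint u * u) $$ (0, 0) = (\<Sum>i<n. conjugate (u $$ (i, 0)) * u $$ (i, 0))"
    by (auto simp: scalar_prod_def lessThan_atLeast0)
  thus ?thesis using True by (auto simp: unit_col_def mat_eq_iff)
qed (auto simp: unit_col_def)

lemma ex_unit_col_smult:
  fixes x :: "complex mat"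
  assumes x: "x \<in> carrier_mat n 1" and nz: "x \<noteq> 0\<^sub>m n 1"
  shows "\<exists>c. unit_col n (c \<cdot>\<^sub>m x)"
proof -
  let ?s = "\<Sum>i<n. (cmod (x $$ (i, 0)))\<^sup>2"
  obtain i where "i < n" "x $$ (i, 0) \<noteq> 0"
    using x nz by (auto simp: mat_eq_iff)
  hence pos: "0 < ?s" by (intro sum_pos2[of _ i]) auto
  let ?c = "complex_of_real (1 / sqrt ?s)"
  have "(\<Sum>i<n. conjugate ((?c \<cdot>\<^sub>m x) $$ (i, 0)) * (?c \<cdot>\<^sub>m x) $$ (i, 0))
    = (\<Sum>i<n. of_real (1 / ?s) * of_real ((cmod (x $$ (i, 0)))\<^sup>2))"
  proof (intro sum.cong refl)
    fix i assume "i \<in> {..<n}"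
    hence "conjugate ((?c \<cdot>\<^sub>m x) $$ (i, 0)) * (?c \<cdot>\<^sub>m x) $$ (i, 0)
      = ?c * ?c * (x $$ (i, 0) * cnj (x $$ (i, 0)))" using x by simp
    also have "?c * ?c = of_real (1 / ?s)"
      unfolding of_real_mult[symmetric] using pos by simp
    also have "x $$ (i, 0) * cnj (x $$ (i, 0)) = of_real ((cmod (x $$ (i, 0)))\<^sup>2)"
      by (rule complex_norm_square[symmetric])
    finally show "conjugate ((?c \<cdot>\<^sub>m x) $$ (i, 0)) * (?c \<cdot>\<^sub>m x) $$ (i, 0)
      = of_real (1 / ?s) * of_real ((cmod (x $$ (i, 0)))\<^sup>2)" .
  qed
  also have "\<dots> = of_real (1 / ?s) * of_real ?s"
    by (simp only: sum_distrib_left of_real_sum)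
  also have "\<dots> = 1" unfolding of_real_mult[symmetric] using pos by simp
  finally show ?thesis using x by (auto simp: unit_col_iff intro!: exI[of _ ?c])
qed

text \<open>A Householder reflection maps \<open>u\<close> to a multiple of the first basis vector; adding the phase
  \<open>\<alpha>\<close> of the first entry of \<open>u\<close> keeps the reflection vector away from zero.\<close>

lemma complex_unitary_completion:
  fixes u :: "complex mat"
  assumes u: "unit_col (Suc n) u"
  shows "\<exists>U. unitary_mat (Suc n) U \<and> U * basis_col (Suc n) 0 = u"
proof -
  let ?n = "Suc n"
  have uc: "u \<in> carrier_mat ?n 1" and us: "(\<Sum>i<?n. cnj (u $$ (i, 0)) * u $$ (i, 0)) = 1"
    using u by (auto simp: unit_col_iff simp del: sum.lessThan_Suc)
  define c where "c = cmod (u $$ (0, 0))"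
  have c0: "c \<ge> 0" by (simp add: c_def)
  hence "complex_of_real (1 + c) \<noteq> 0" unfolding of_real_eq_0_iff by linarith
  hence cc: "1 + complex_of_real c \<noteq> 0" by simp
  define \<alpha> where "\<alpha> = (if u $$ (0, 0) = 0 then 1 else u $$ (0, 0) / c)"
  have "cmod \<alpha> = 1" by (simp add: \<alpha>_def c_def norm_divide)
  hence \<alpha>: "\<alpha> * cnj \<alpha> = 1" using complex_norm_square[of \<alpha>] by simp
  have u0: "u $$ (0, 0) = \<alpha> * c" by (auto simp: \<alpha>_def c_def)
  define w where "w i = u $$ (i, 0) + (if i = 0 then \<alpha> else 0)" for i
  \<comment> \<open>With \<open>w = u + \<alpha> e\<close>, where \<open>e\<close> is the first
    basis vector, the squared length of \<open>w\<close> is \<open>2 (1 + c)\<close>. So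
    \<open>k\<close> is 2 over that length, the coefficient of the reflection
    \<open>1 - k w w*\<close>.\<close>
  define k where "k = 1 / (1 + complex_of_real c)"
  have k0: "k \<noteq> 0" and kc: "k * (1 + c) = 1" and kcnj: "cnj k = k" using cc by (auto simp: k_def)
  have split: "(\<Sum>i<?n. f i * (if i = 0 then a else 0)) = f 0 * a" for f and a :: complex
    by (simp add: if_distrib cong: if_cong del: sum.lessThan_Suc)
  have ww: "(\<Sum>i<?n. cnj (w i) * w i) = 2 / k"
  proof -
    have "(\<Sum>i<?n. cnj (w i) * w i) = (\<Sum>i<?n. cnj (u $$ (i, 0)) * u $$ (i, 0))
      + (\<Sum>i<?n. cnj (u $$ (i, 0)) * (if i = 0 then \<alpha> else 0))
      + (\<Sum>i<?n. u $$ (i, 0) * (if i = 0 then cnj \<alpha> else 0))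
      + (\<Sum>i<?n. cnj \<alpha> * (if i = 0 then \<alpha> else 0))"
      unfolding sum.distrib[symmetric] by (intro sum.cong) (auto simp: w_def algebra_simps)
    also have "\<dots> = 1 + cnj (u $$ (0, 0)) * \<alpha> + u $$ (0, 0) * cnj \<alpha> + cnj \<alpha> * \<alpha>"
      by (simp only: us split)
    also have "\<dots> = 2 + 2 * c * (\<alpha> * cnj \<alpha>)" using \<alpha> by (simp add: u0 algebra_simps)
    finally show ?thesis by (simp add: \<alpha> k_def)
  qed
  define H where "H = mat ?n ?n (\<lambda>(i, j). (if i = j then 1 else 0) - k * w i * cnj (w j))"
  have Hc: "H \<in> carrier_mat ?n ?n" by (simp add: H_def)
  have adj: "adjoint H = H"
    by (rule eq_matI) (auto simp: H_def kcnj)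
  have HH: "H * H = 1\<^sub>m ?n"
  proof (rule eq_matI)
    fix i j assume ij: "i < dim_row (1\<^sub>m ?n :: complex mat)" "j < dim_col (1\<^sub>m ?n :: complex mat)"
    have "(H * H) $$ (i, j) = (\<Sum>l<?n. H $$ (i, l) * H $$ (l, j))"
      using ij Hc by (auto simp: scalar_prod_def lessThan_atLeast0)
    also have "\<dots> = (\<Sum>l<?n. (if l = i then if i = j then 1 else 0 else 0)
       - (if l = i then k * w i * cnj (w j) else 0) - (if l = j then k * w i * cnj (w j) else 0)
       + k * k * w i * cnj (w j) * (cnj (w l) * w l))"
      using ij by (intro sum.cong) (auto simp: H_def algebra_simps)
    also have "\<dots> = (if i = j then 1 else 0) - k * w i * cnj (w j) - k * w i * cnj (w j)
       + k * k * w i * cnj (w j) * (\<Sum>l<?n. cnj (w l) * w l)"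
      using ij by (simp add: sum.distrib sum_subtractf sum_distrib_left del: sum.lessThan_Suc)
    also have "\<dots> = (if i = j then 1 else 0)" unfolding ww using k0 by (simp add: field_simps)
    finally show "(H * H) $$ (i, j) = 1\<^sub>m ?n $$ (i, j)" using ij by simp
  qed (use Hc in auto)
  have H: "unitary_mat ?n H" using Hc HH by (simp add: unitary_mat_def adj)
  \<comment> \<open>The reflection maps \<open>u\<close> to \<open>- \<alpha> e\<close> and is its
    own inverse; the unimodular factor \<open>- \<alpha>\<close> then gives exactly
    \<open>u\<close>.\<close>
  have "(- \<alpha> \<cdot>\<^sub>m H) * basis_col ?n 0 = u"
  proof (rule eq_matI)
    fix i j assume ij: "i < dim_row u" "j < dim_col u"
    hence i: "i < ?n" and j: "j = 0" using uc by auto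
    have "((- \<alpha> \<cdot>\<^sub>m H) * basis_col ?n 0) $$ (i, 0) = - \<alpha> * H $$ (i, 0)"
      using Hc i by (subst mult_basis_col[of _ ?n]) auto
    also have "\<dots> = (if i = 0 then - \<alpha> else 0) + k * w i * (\<alpha> * cnj (w 0))"
      using i by (auto simp: H_def algebra_simps)
    also have "\<alpha> * cnj (w 0) = (\<alpha> * cnj \<alpha>) * (1 + c)" by (simp add: w_def u0 algebra_simps)
    also have "k * w i * \<dots> = w i" using arg_cong[OF kc, of "\<lambda>x. w i * x"] by (simp add: \<alpha> algebra_simps)
    finally show "((- \<alpha> \<cdot>\<^sub>m H) * basis_col ?n 0) $$ (i, j) = u $$ (i, j)"
      by (simp add: j w_def)
  qed (use uc Hc in auto)
  moreover have "unitary_mat ?n (- \<alpha> \<cdot>\<^sub>m H)"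
    using H \<alpha> by (intro unitary_mat_smult) auto
  ultimately show ?thesis by blast
qed

text \<open>Bridge from eigenvectors and kernels, which are about vectors, to one-column
  matrices.\<close>

lemma ex_col_mat:
  fixes v :: "'a :: comm_ring_1 vec"
  assumes v: "v \<in> carrier_vec n" "v \<noteq> 0\<^sub>v n"
  shows "\<exists>x. x \<in> carrier_mat n 1 \<and> x \<noteq> 0\<^sub>m n 1 \<and>
    (\<forall>A k. A \<in> carrier_mat n n \<longrightarrow> A *\<^sub>v v = k \<cdot>\<^sub>v v \<longrightarrow> A * x = k \<cdot>\<^sub>m x)"
proof -
  let ?x = "mat n 1 (\<lambda>(i, j). v $ i)"
  have col: "col ?x 0 = v" using v by (intro eq_vecI) auto
  have "?x \<noteq> 0\<^sub>m n 1"
  proof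
    assume "?x = 0\<^sub>m n 1"
    hence "v = col (0\<^sub>m n 1) 0" using col by simp
    thus False using v by simp
  qed
  moreover have "A * ?x = k \<cdot>\<^sub>m ?x" if "A \<in> carrier_mat n n" "A *\<^sub>v v = k \<cdot>\<^sub>v v" for A k
  proof (rule eq_matI)
    fix i j assume ij: "i < dim_row (k \<cdot>\<^sub>m ?x)" "j < dim_col (k \<cdot>\<^sub>m ?x)"
    hence "(A * ?x) $$ (i, j) = (A *\<^sub>v v) $ i" using that(1) col by simp
    thus "(A * ?x) $$ (i, j) = (k \<cdot>\<^sub>m ?x) $$ (i, j)" using ij v unfolding that(2) by simp
  qed (use that(1) in auto)
  ultimately show ?thesis by (intro exI[of _ ?x]) auto
qed

lemma complex_unit_eigencol:
  fixes A :: "complex mat"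
  assumes A: "A \<in> carrier_mat n n" and v: "v \<in> carrier_vec n" "v \<noteq> 0\<^sub>v n" "A *\<^sub>v v = k \<cdot>\<^sub>v v"
  shows "\<exists>x. unit_col n x \<and> A * x = k \<cdot>\<^sub>m x"
proof -
  from ex_col_mat[OF v(1,2)] A v(3) obtain x where x: "x \<in> carrier_mat n 1" "x \<noteq> 0\<^sub>m n 1"
    and Ax: "A * x = k \<cdot>\<^sub>m x" by blast
  from ex_unit_col_smult[OF x] obtain c where "unit_col n (c \<cdot>\<^sub>m x)" ..
  moreover have "A * (c \<cdot>\<^sub>m x) = k \<cdot>\<^sub>m (c \<cdot>\<^sub>m x)"
    using A x Ax by (auto simp: mult_smult_distrib[of _ n n _ 1])
  ultimately show ?thesis by blast
qed

text \<open>For a unit eigenvector \<open>v\<close> of \<open>A* A\<close> the eigenvalue is the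
  squared length of \<open>A v\<close>, hence real and nonnegative. Its root is \<sigma>, and
  \<open>u\<close> is \<open>A v\<close> divided by \<sigma>, or a unit vector of the kernel of
  \<open>A*\<close> if \<sigma> is 0.\<close>

lemma complex_singular_pair:
  fixes A :: "complex mat"
  assumes A: "A \<in> carrier_mat (Suc n) (Suc n)"
  shows "\<exists>\<sigma> u v. (\<exists>r\<ge>0. \<sigma> = complex_of_real r) \<and> singular_pair (Suc n) A \<sigma> u v"
proof -
  let ?n = "Suc n"
  have AA: "adjoint A * A \<in> carrier_mat ?n ?n" using A by auto
  from spectrum_non_empty[OF AA] obtain k v' where "eigenvector (adjoint A * A) v' k"
    by (auto simp: spectrum_def eigenvalue_def)
  hence "v' \<in> carrier_vec ?n" "v' \<noteq> 0\<^sub>v ?n" "(adjoint A * A) *\<^sub>v v' = k \<cdot>\<^sub>v v'"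
    using A by (auto simp: eigenvector_def)
  from complex_unit_eigencol[OF AA this] obtain v where v: "unit_col ?n v"
    and kv: "adjoint A * A * v = k \<cdot>\<^sub>m v" by blast
  have vc: "v \<in> carrier_mat ?n 1" using v by (simp add: unit_col_def)
  have kv': "adjoint A * (A * v) = k \<cdot>\<^sub>m v"
    using A vc kv by (simp add: assoc_mult_mat[of _ ?n ?n _ ?n _ 1])
  define w where "w = A * v"
  have wc: "w \<in> carrier_mat ?n 1" using A vc by (simp add: w_def)
  define \<rho> where "\<rho> = (\<Sum>i<?n. (cmod (w $$ (i, 0)))\<^sup>2)"
  have "adjoint w * w = adjoint v * (adjoint A * w)"
    using A vc wc by (simp add: w_def adjoint_mult[of A ?n ?n v 1]
        assoc_mult_mat[of "adjoint v" 1 ?n "adjoint A" ?n "A * v" 1])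
  also have "\<dots> = k \<cdot>\<^sub>m 1\<^sub>m 1"
    using vc v by (simp add: w_def kv' mult_smult_distrib[of _ 1 ?n _ 1] unit_col_def)
  finally have "(adjoint w * w) $$ (0, 0) = k" by simp
  moreover have "(adjoint w * w) $$ (0, 0) = (\<Sum>i<?n. w $$ (i, 0) * cnj (w $$ (i, 0)))"
    using wc by (auto simp: scalar_prod_def lessThan_atLeast0 mult.commute simp del: sum.op_ivl_Suc)
  ultimately have k: "k = of_real \<rho>"
    by (simp only: \<rho>_def of_real_sum complex_norm_square)
  have \<rho>0: "\<rho> \<ge> 0" unfolding \<rho>_def by (intro sum_nonneg) auto
  show ?thesis
  proof (cases "\<rho> = 0")
    case False
    let ?s = "complex_of_real (sqrt \<rho>)"
    have s: "?s \<noteq> 0" "?s * ?s = k" using False \<rho>0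
      by (auto simp: k simp flip: of_real_mult)
    let ?u = "(1 / ?s) \<cdot>\<^sub>m w"
    have "adjoint ?u * ?u = (conjugate (1 / ?s) * (1 / ?s)) \<cdot>\<^sub>m (adjoint w * w)"
      using wc by (auto simp: adjoint_smult mult_smult_distrib[of _ 1 ?n _ 1]
        mult_smult_assoc_mat[of _ 1 ?n _ 1] mult.assoc intro!: eq_matI)
    also have "\<dots> = (k / (?s * ?s)) \<cdot>\<^sub>m 1\<^sub>m 1"
      using \<open>adjoint v * (adjoint A * w) = k \<cdot>\<^sub>m 1\<^sub>m 1\<close> \<open>adjoint w * w = adjoint v * (adjoint A * w)\<close>
      by (auto intro!: eq_matI)
    also have "\<dots> = 1\<^sub>m 1" using s(1) unfolding s(2)[symmetric] by (auto intro!: eq_matI)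
    finally have "unit_col ?n ?u" using wc by (simp add: unit_col_def)
    moreover have "A * v = ?s \<cdot>\<^sub>m ?u" using wc s by (auto simp: w_def intro!: eq_matI)
    moreover have "adjoint A * ?u = ?s \<cdot>\<^sub>m v"
      using A wc vc s unfolding s(2)[symmetric]
      by (auto simp: mult_smult_distrib[of _ ?n ?n _ 1] kv'[folded w_def] s(2)[symmetric]
        simp del: of_real_sqrt intro!: eq_matI)
    ultimately show ?thesis using v \<rho>0
      by (intro exI[of _ ?s] exI[of _ ?u] exI[of _ v]) (auto simp: singular_pair_def)
  next
    case True
    hence "\<forall>i<?n. w $$ (i, 0) = 0"
      unfolding \<rho>_def by (subst (asm) sum_nonneg_eq_0_iff) auto
    hence w0: "A * v = 0\<^sub>m ?n 1" using wc unfolding w_def[symmetric] by (auto intro!: eq_matI)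
    \<comment> \<open>\<open>A\<close> kills the nonzero \<open>v\<close>, whereas an inverse of
      \<open>adjoint A\<close> would yield a left inverse of \<open>A\<close>.\<close>
    have "det (adjoint A) = 0"
    proof (rule ccontr)
      assume "det (adjoint A) \<noteq> 0"
      from det_non_zero_imp_unit[OF _ this, of ?n "()"] A
      obtain B where B: "B \<in> carrier_mat ?n ?n" "adjoint A * B = 1\<^sub>m ?n"
        by (auto simp: Units_def ring_mat_def)
      have "adjoint B * A = adjoint (adjoint A * B)"
        using A B(1) by (simp add: adjoint_mult[of _ ?n ?n _ ?n])
      hence "adjoint B * A = 1\<^sub>m ?n" by (simp add: B(2))
      hence "v = adjoint B * (A * v)"
        using A B vc by (simp flip: assoc_mult_mat[of _ ?n ?n _ ?n _ 1])
      hence "v = 0\<^sub>m ?n 1" using B unfolding w0 by simp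
      thus False using v by (simp add: unit_col_iff del: sum.lessThan_Suc)
    qed
    then obtain u' where u': "u' \<in> carrier_vec ?n" "u' \<noteq> 0\<^sub>v ?n" "adjoint A *\<^sub>v u' = 0\<^sub>v ?n"
      using det_0_iff_vec_prod_zero[of "adjoint A" ?n] A by auto
    hence "adjoint A *\<^sub>v u' = 0 \<cdot>\<^sub>v u'" by (auto intro!: eq_vecI)
    from complex_unit_eigencol[OF _ u'(1,2) this] A obtain u where u: "unit_col ?n u"
      "adjoint A * u = 0 \<cdot>\<^sub>m u" by auto
    have "A * v = 0 \<cdot>\<^sub>m u" "0 \<cdot>\<^sub>m u = 0 \<cdot>\<^sub>m v"
      using w0 u vc by (auto simp: unit_col_def intro!: eq_matI)
    thus ?thesis using u v
      by (intro exI[of _ 0] exI[of _ u] exI[of _ v]) (auto simp: singular_pair_def)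
  qed
qed

lemma complex_svd:
  fixes A :: "complex mat"
  assumes "A \<in> carrier_mat n n"
  shows "\<exists>P V d. unitary_mat n P \<and> unitary_mat n V \<and> (\<forall>i<n. 0 \<le> d i) \<and>
    A = P * mat_diag n (\<lambda>i. complex_of_real (d i)) * adjoint V"
proof -
  let ?Q = "\<lambda>\<sigma>. \<exists>r\<ge>0. \<sigma> = complex_of_real r"
  have "\<exists>P V d. unitary_mat n P \<and> unitary_mat n V \<and> (\<forall>i<n. ?Q (d i)) \<and>
    A = P * mat_diag n d * adjoint V"
    by (rule unitary_diagonalization[OF complex_unitary_completion complex_singular_pair _ assms])
      auto
  then obtain P V d where PV: "unitary_mat n P" "unitary_mat n V" and d: "\<forall>i<n. ?Q (d i)"
    and A: "A = P * mat_diag n d * adjoint V" by blast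
  have "mat_diag n d = mat_diag n (\<lambda>i. complex_of_real (Re (d i)))"
    using d by (fastforce simp: mat_diag_def intro!: eq_matI)
  thus ?thesis using PV d A by (intro exI[of _ P] exI[of _ V] exI[of _ "\<lambda>i. Re (d i)"]) auto
qed

text \<open>For Hermitian \<open>C\<close> a singular pair satisfies \<open>C v = s u\<close> and
  \<open>C u = s v\<close>. Hence \<open>u + v\<close> is an eigenvector for \<open>s\<close>,
  unless it vanishes, and then \<open>u\<close> is one for \<open>- s\<close>. The eigenvalue must
  be nonzero because this later confines the eigenvector to the rows where \<open>C\<close> is
  supported.\<close>

lemma hermitian_nonzero_eigencol:
  fixes C :: "complex mat"
  assumes C: "C \<in> carrier_mat n n" and herm: "adjoint C = C" and nz: "C \<noteq> 0\<^sub>m n n"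
  shows "\<exists>x l. unit_col n x \<and> l \<noteq> 0 \<and> C * x = complex_of_real l \<cdot>\<^sub>m x"
proof -
  from complex_svd[OF C] obtain P V d where P: "unitary_mat n P" and V: "unitary_mat n V"
    and CD: "C = P * mat_diag n (\<lambda>i. complex_of_real (d i)) * adjoint V" by blast
  have "\<exists>i<n. d i \<noteq> 0"
  proof (rule ccontr)
    assume "\<not> (\<exists>i<n. d i \<noteq> 0)"
    hence "mat_diag n (\<lambda>i. complex_of_real (d i)) = 0\<^sub>m n n"
      by (auto simp: mat_diag_def intro!: eq_matI)
    thus False using nz unitary_matD(1,2)[OF P] unitary_matD(1,2)[OF V] by (simp add: CD)
  qed
  then obtain i where i: "i < n" "d i \<noteq> 0" by blast
  let ?s = "complex_of_real (d i)"
  from singular_pair_unitary[OF P V mat_diag_dim singular_pair_mat_diag[OF i(1), of "\<lambda>i. complex_of_real (d i)"]]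
  obtain u v where u: "unit_col n u" and v: "unit_col n v" and e: "C * v = ?s \<cdot>\<^sub>m u" "C * u = ?s \<cdot>\<^sub>m v"
    using herm by (auto simp: CD[symmetric] singular_pair_def)
  have c: "u \<in> carrier_mat n 1" "v \<in> carrier_mat n 1" using u v by (auto simp: unit_col_def)
  show ?thesis
  proof (cases "u + v = 0\<^sub>m n 1")
    case True
    have "v $$ (j, 0) = - u $$ (j, 0)" if "j < n" for j
      using arg_cong[OF True, of "\<lambda>M. M $$ (j, 0)"] c that
      by (simp add: eq_neg_iff_add_eq_0 add.commute)
    hence "v = - u" using c by (auto intro!: eq_matI)
    hence "C * u = complex_of_real (- d i) \<cdot>\<^sub>m u" using e c by (auto intro!: eq_matI)
    thus ?thesis using u i by (intro exI[of _ u] exI[of _ "- d i"]) auto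
  next
    case False
    from ex_unit_col_smult[OF _ this] c obtain k where k: "unit_col n (k \<cdot>\<^sub>m (u + v))" by auto
    have "C * (k \<cdot>\<^sub>m (u + v)) = k \<cdot>\<^sub>m (C * u + C * v)"
      using C c by (simp add: mult_smult_distrib[of _ n n _ 1] mult_add_distrib_mat[of _ n n _ 1])
    also have "\<dots> = ?s \<cdot>\<^sub>m (k \<cdot>\<^sub>m (u + v))"
      using c by (auto simp: e algebra_simps intro!: eq_matI)
    finally show ?thesis using k i by blast
  qed
qed

section \<open>Dual complex matrices\<close>

text \<open>Splits an identity of dual matrices into two identities of ordinary ones, with products
  following the Leibniz rule.\<close>

definition dual_mat :: "'a mat \<Rightarrow> 'a mat \<Rightarrow> 'a dual_number mat" where
  "dual_mat S T = mat (dim_row S) (dim_col S) (\<lambda>ij. Dual (S $$ ij) (T $$ ij))"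

lemma dual_mat_carrier [simp]:
  "dual_mat S T \<in> carrier_mat n m \<longleftrightarrow> S \<in> carrier_mat n m"
  "dim_row (dual_mat S T) = dim_row S" "dim_col (dual_mat S T) = dim_col S"
  "i < dim_row S \<Longrightarrow> j < dim_col S \<Longrightarrow> dual_mat S T $$ (i, j) = Dual (S $$ (i, j)) (T $$ (i, j))"
  unfolding dual_mat_def carrier_mat_def by auto

lemma dual_mat_parts: "dual_mat (map_mat std_part A) (map_mat inf_part A) = A"
  by (rule eq_matI) auto

lemma sum_dual_number:
  fixes f :: "'b \<Rightarrow> 'a :: comm_ring_1 dual_number"
  shows "sum f I = Dual (\<Sum>i\<in>I. std_part (f i)) (\<Sum>i\<in>I. inf_part (f i))"
  by (induction I rule: infinite_finite_induct)
    (auto simp: zero_dual_number_def plus_dual_number_def)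

lemma dual_mat_mult:
  fixes S T S' T' :: "'a :: comm_ring_1 mat"
  assumes "S \<in> carrier_mat n m" "T \<in> carrier_mat n m" "S' \<in> carrier_mat m k" "T' \<in> carrier_mat m k"
  shows "dual_mat S T * dual_mat S' T' = dual_mat (S * S') (S * T' + T * S')"
  using assms
  by (intro eq_matI)
    (auto simp: scalar_prod_def sum_dual_number times_dual_number_def sum.distrib)

lemma dual_mat_one: "dual_mat (1\<^sub>m n) (0\<^sub>m n n) = (1\<^sub>m n :: 'a :: comm_ring_1 dual_number mat)"
  by (rule eq_matI) (auto simp: one_dual_number_def zero_dual_number_def)

lemma dual_mat_smult:
  fixes S T :: "'a :: comm_ring_1 mat"
  assumes "S \<in> carrier_mat n m" "T \<in> carrier_mat n m"
  shows "Dual a b \<cdot>\<^sub>m dual_mat S T = dual_mat (a \<cdot>\<^sub>m S) (a \<cdot>\<^sub>m T + b \<cdot>\<^sub>m S)"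
  using assms by (intro eq_matI) (auto simp: times_dual_number_def)

lemma adjoint_dual_mat:
  fixes S T :: "'a :: {comm_ring_1, conjugatable_ring} mat"
  assumes "S \<in> carrier_mat n m" "T \<in> carrier_mat n m"
  shows "adjoint (dual_mat S T) = dual_mat (adjoint S) (adjoint T)"
  using assms by (intro eq_matI) (auto simp: conjugate_dual_number_def)

lemma dual_mat_cong:
  assumes "S \<in> carrier_mat n m"
    and "\<And>i j. i < n \<Longrightarrow> j < m \<Longrightarrow> S $$ (i, j) = S' $$ (i, j)"
    and "\<And>i j. i < n \<Longrightarrow> j < m \<Longrightarrow> T $$ (i, j) = T' $$ (i, j)"
    and "S' \<in> carrier_mat n m"
  shows "dual_mat S T = dual_mat S' T'"
  using assms by (intro eq_matI) auto

lemma unitary_dual_mat_const: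
  fixes P :: "'a :: {comm_ring_1, conjugatable_ring} mat"
  assumes "unitary_mat n P"
  shows "unitary_mat n (dual_mat P (0\<^sub>m n n))"
  using unitary_matD[OF assms] right_mult_zero_mat[of P n n n]
    right_mult_zero_mat[of "adjoint P" n n n]
  by (simp add: unitary_mat_def adjoint_dual_mat[of P n n] dual_mat_mult[of _ n n _ _ n]
      left_mult_zero_mat[of _ n n] dual_mat_one)

text \<open>Skew-Hermitian matrices are the tangent directions of the unitary group at 1: the
  adjoint of \<open>1 + \<epsilon> X\<close> is \<open>1 - \<epsilon> X\<close>, and the first-order
  terms cancel.\<close>

lemma unitary_dual_mat_skew:
  fixes X :: "'a :: {comm_ring_1, conjugatable_ring} mat"
  assumes X: "X \<in> carrier_mat n n"
    and skew: "\<And>i j. i < n \<Longrightarrow> j < n \<Longrightarrow> conjugate (X $$ (j, i)) = - X $$ (i, j)"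
  shows "unitary_mat n (dual_mat (1\<^sub>m n) X)"
proof -
  have adj: "adjoint X = - X" using X skew by (intro eq_matI) auto
  have "- X + X = 0\<^sub>m n n" "X + - X = 0\<^sub>m n n" using X by (auto intro!: eq_matI)
  thus ?thesis using X
    by (simp add: unitary_mat_def adjoint_dual_mat[of _ n n] adj dual_mat_mult[of _ n n _ _ n]
      dual_mat_one)
qed

lemma dual_mat_basis_col:
  "dual_mat (basis_col n k) (0\<^sub>m n 1) = basis_col n k"
  by (rule eq_matI) (auto simp: basis_col_def one_dual_number_def zero_dual_number_def)

text \<open>Complete the standard part to \<open>P\<close>; then the unit length of \<open>u\<close> makes the first entry of
  \<open>P\<^sup>* u\<^sub>d\<close> imaginary, so that this vector is the first column of a skew-Hermitian \<open>X\<close>, and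
  \<open>P (1 + \<epsilon> X)\<close> is the completion of \<open>u\<close>.\<close>

lemma dual_unitary_completion:
  fixes u :: "dual_complex mat"
  assumes u: "unit_col (Suc n) u"
  shows "\<exists>U. unitary_mat (Suc n) U \<and> U * basis_col (Suc n) 0 = u"
proof -
  let ?n = "Suc n"
  let ?e = "basis_col ?n 0 :: complex mat"
  define x where "x = map_mat std_part u"
  define p where "p = map_mat inf_part u"
  have uc: "u \<in> carrier_mat ?n 1" using u by (simp add: unit_col_def)
  hence xc: "x \<in> carrier_mat ?n 1" and pc: "p \<in> carrier_mat ?n 1" by (auto simp: x_def p_def)
  have ux: "u = dual_mat x p" by (simp add: x_def p_def dual_mat_parts)
  have "Dual (\<Sum>i<?n. cnj (x $$ (i, 0)) * x $$ (i, 0))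
      (\<Sum>i<?n. cnj (x $$ (i, 0)) * p $$ (i, 0) + cnj (p $$ (i, 0)) * x $$ (i, 0))
    = (\<Sum>i<?n. conjugate (u $$ (i, 0)) * u $$ (i, 0))"
    using xc pc unfolding ux sum_dual_number
    by (intro arg_cong2[of _ _ _ _ Dual] sum.cong)
      (auto simp: times_dual_number_def conjugate_dual_number_def)
  also have "\<dots> = Dual 1 0" using u by (simp only: unit_col_iff one_dual_number_def)
  finally have s: "(\<Sum>i<?n. cnj (x $$ (i, 0)) * x $$ (i, 0)) = 1"
    and i: "(\<Sum>i<?n. cnj (x $$ (i, 0)) * p $$ (i, 0) + cnj (p $$ (i, 0)) * x $$ (i, 0)) = 0"
    by (simp_all only: dual_number.inject)
  have "unit_col ?n x" using s xc by (simp add: unit_col_iff del: sum.lessThan_Suc)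
  from complex_unitary_completion[OF this] obtain P where P: "unitary_mat ?n P" and Pe: "P * ?e = x"
    by blast
  note c = unitary_matD(1,2)[OF P]
  define z where "z = adjoint P * p"
  have zc: "z \<in> carrier_mat ?n 1" using c pc by (simp add: z_def)
  have P0: "P $$ (i, 0) = x $$ (i, 0)" if "i < ?n" for i
    using mult_basis_col[OF c(1) zero_less_Suc that] by (simp add: Pe)
  have z0: "z $$ (0, 0) = (\<Sum>i<?n. cnj (x $$ (i, 0)) * p $$ (i, 0))"
    using c pc P0 by (auto simp: z_def scalar_prod_def lessThan_atLeast0 simp del: sum.op_ivl_Suc)
  have "cnj (z $$ (0, 0)) = (\<Sum>i<?n. cnj (p $$ (i, 0)) * x $$ (i, 0))"
    unfolding z0 cnj_sum by (intro sum.cong) auto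
  hence im: "cnj (z $$ (0, 0)) = - z $$ (0, 0)"
    using i unfolding sum.distrib z0[symmetric] by (simp add: eq_neg_iff_add_eq_0 add.commute)
  \<comment> \<open>The first column is prescribed and skewness forces the first row; they meet in
    the corner, where \<open>z\<close> is imaginary. The remaining entries are free.\<close>
  define X where "X = mat ?n ?n (\<lambda>(i, j).
    if j = 0 then z $$ (i, 0) else if i = 0 then - cnj (z $$ (j, 0)) else 0)"
  have Xc: "X \<in> carrier_mat ?n ?n" by (simp add: X_def)
  have Xe: "X * ?e = z"
  proof (rule eq_matI)
    fix i j assume "i < dim_row z" "j < dim_col z"
    thus "(X * ?e) $$ (i, j) = z $$ (i, j)"
      using mult_basis_col[OF Xc zero_less_Suc, of i] zc by (auto simp: X_def)
  qed (use zc Xc in auto)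
  let ?P = "dual_mat P (0\<^sub>m ?n ?n)" and ?X = "dual_mat (1\<^sub>m ?n) X"
  have U: "unitary_mat ?n (?P * ?X)"
    by (intro unitary_mat_mult unitary_dual_mat_const[OF P] unitary_dual_mat_skew[OF Xc])
      (use im in \<open>auto simp: X_def\<close>)
  have "?P * ?X * basis_col ?n 0 = ?P * (?X * dual_mat ?e (0\<^sub>m ?n 1))"
    unfolding dual_mat_basis_col using c Xc by (intro assoc_mult_mat[of _ ?n ?n _ ?n _ 1]) auto
  also have "?X * dual_mat ?e (0\<^sub>m ?n 1) = dual_mat ?e z"
    using Xc zc by (subst dual_mat_mult[of _ ?n ?n _ _ 1]) (auto simp: Xe)
  also have "?P * dual_mat ?e z = dual_mat x (P * z)"
    using c zc by (subst dual_mat_mult[of _ ?n ?n _ _ 1]) (auto simp: Pe)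
  also have "P * z = p" unfolding z_def by (rule unitary_mat_cancel(2)[OF P pc])
  finally show ?thesis using U by (auto simp: ux)
qed

text \<open>Among the vectors with \<open>\<Sigma> x = s x\<close> there is an eigenvector \<open>x\<close> of the compression of the
  Hermitian part of \<open>B\<close>; it extends to a dual singular pair \<open>u = x + \<epsilon> p\<close>, \<open>v = x + \<epsilon> q\<close>.
  The equations for \<open>p\<close> and \<open>q\<close> decouple into \<open>2 \<times> 2\<close> systems with determinant
  \<open>s\<^sup>2 - d\<^sub>i\<^sup>2\<close>, where the singular ones are consistent by the choice of \<open>x\<close>.\<close>

lemma singular_pair_perturbation:
  fixes d :: "nat \<Rightarrow> real" and B :: "complex mat"
  assumes B: "B \<in> carrier_mat n n" and d: "\<And>i. i < n \<Longrightarrow> 0 \<le> d i" and k: "k < n" "0 < d k"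
  shows "\<exists>l u v. singular_pair n (dual_mat (mat_diag n (\<lambda>i. complex_of_real (d i))) B)
    (Dual (complex_of_real (d k)) (complex_of_real l)) u v"
proof -
  let ?s = "complex_of_real (d k)" and ?d = "\<lambda>i. complex_of_real (d i)"
  let ?S = "mat_diag n ?d"
  \<comment> \<open>The Hermitian part of \<open>B\<close>, cut down to the indices with singular
    value \<open>d k\<close>. The half makes its eigenvalue \<open>l\<close> the first-order change
    of that value.\<close>
  define C where "C = mat n n (\<lambda>(i, j).
    if d i = d k \<and> d j = d k then (B $$ (i, j) + cnj (B $$ (j, i))) / 2 else 0)"
  have Cc: "C \<in> carrier_mat n n" by (simp add: C_def)
  have herm: "adjoint C = C" by (rule eq_matI) (auto simp: C_def add.commute)
  \<comment> \<open>A nonzero eigenvalue forces \<open>x\<close> to vanish wherever the rows of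
    \<open>C\<close> do. If \<open>C\<close> is zero this argument fails, and a basis vector with
    \<open>l = 0\<close> is taken instead.\<close>
  have "\<exists>x l. unit_col n x \<and> C * x = complex_of_real l \<cdot>\<^sub>m x \<and> (\<forall>i<n. d i \<noteq> d k \<longrightarrow> x $$ (i, 0) = 0)"
  proof (cases "C = 0\<^sub>m n n")
    case True
    show ?thesis using unit_col_basis[OF k(1)]
      by (intro exI[of _ "basis_col n k"] exI[of _ 0])
        (auto simp: True left_mult_zero_mat[of _ n 1] basis_col_def intro!: eq_matI)
  next
    case False
    from hermitian_nonzero_eigencol[OF Cc herm False] obtain x l where x: "unit_col n x" and l: "l \<noteq> 0"
      and Cx: "C * x = complex_of_real l \<cdot>\<^sub>m x" by blast
    have "x $$ (i, 0) = 0" if i: "i < n" "d i \<noteq> d k" for i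
    proof -
      have xc: "x \<in> carrier_mat n 1" using x by (simp add: unit_col_def)
      hence "(C * x) $$ (i, 0) = 0" using i by (auto simp: C_def scalar_prod_def)
      thus ?thesis using l i xc by (simp add: Cx)
    qed
    thus ?thesis using x Cx by blast
  qed
  then obtain x l where x: "unit_col n x" and Cx: "C * x = complex_of_real l \<cdot>\<^sub>m x"
    and x0: "\<And>i. i < n \<Longrightarrow> d i \<noteq> d k \<Longrightarrow> x $$ (i, 0) = 0" by blast
  have xc: "x \<in> carrier_mat n 1" and xs: "(\<Sum>i<n. cnj (x $$ (i, 0)) * x $$ (i, 0)) = 1"
    using x by (auto simp: unit_col_iff)
  let ?l = "complex_of_real l" and ?x = "\<lambda>i. x $$ (i, 0)"
  define b where "b i = (B * x) $$ (i, 0)" for i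
  define b' where "b' i = (adjoint B * x) $$ (i, 0)" for i
  have b: "b i = (\<Sum>j<n. B $$ (i, j) * ?x j)" if "i < n" for i
    using that B xc by (auto simp: b_def scalar_prod_def lessThan_atLeast0)
  have b': "b' i = (\<Sum>j<n. cnj (B $$ (j, i)) * ?x j)" if "i < n" for i
    using that B xc by (auto simp: b'_def scalar_prod_def lessThan_atLeast0)
  \<comment> \<open>The consistency condition: where \<open>d i = d k\<close>, adding the two
    equations for \<open>p\<close> and \<open>q\<close> eliminates both unknowns.\<close>
  have bb: "b i + b' i = 2 * ?l * ?x i" if i: "i < n" "d i = d k" for i
  proof -
    have "b i + b' i = (\<Sum>j<n. 2 * (C $$ (i, j) * ?x j))"
      unfolding b[OF i(1)] b'[OF i(1)] sum.distrib[symmetric]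
      using i x0 by (intro sum.cong) (auto simp: C_def algebra_simps)
    also have "\<dots> = 2 * (C * x) $$ (i, 0)"
      using i Cc xc by (auto simp: scalar_prod_def lessThan_atLeast0 sum_distrib_left)
    finally show ?thesis using i xc by (simp add: Cx)
  qed
  \<comment> \<open>Where \<open>d i = d k\<close> only the difference of \<open>p\<close> and
    \<open>q\<close> is determined, so \<open>q\<close> is set to 0. Elsewhere \<open>x\<close>
    vanishes and the quotients are Cramer's rule.\<close>
  define p where "p = mat n 1 (\<lambda>(i, j). if d i = d k then (b i - ?l * ?x i) / ?s
    else (?s * b i + ?d i * b' i) / (?s * ?s - ?d i * ?d i))"
  define q where "q = mat n 1 (\<lambda>(i, j). if d i = d k then 0
    else (?s * b' i + ?d i * b i) / (?s * ?s - ?d i * ?d i))"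
  have pc: "p \<in> carrier_mat n 1" and qc: "q \<in> carrier_mat n 1" by (auto simp: p_def q_def)
  have det: "?s * ?s - ?d i * ?d i \<noteq> 0" if "i < n" "d i \<noteq> d k" for i
  proof -
    have "?s * ?s - ?d i * ?d i = complex_of_real ((d k - d i) * (d k + d i))"
      by (simp add: algebra_simps)
    \<comment> \<open>Distinct nonnegative values have distinct squares; \<open>d k\<close> being
      positive also keeps the sum nonzero.\<close>
    moreover have "(d k - d i) * (d k + d i) \<noteq> 0" using that d[OF that(1)] k by auto
    ultimately show ?thesis by (metis of_real_eq_0_iff)
  qed
  have eq1: "?d i * q $$ (i, 0) + b i = ?s * p $$ (i, 0) + ?l * ?x i" if i: "i < n" for i
  proof (cases "d i = d k")
    case True
    thus ?thesis using i k by (simp add: p_def q_def)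
  next
    case False
    thus ?thesis using i det[OF i False] x0[OF i False] by (simp add: p_def q_def field_simps)
  qed
  have eq2: "?d i * p $$ (i, 0) + b' i = ?s * q $$ (i, 0) + ?l * ?x i" if i: "i < n" for i
  proof (cases "d i = d k")
    case True
    hence "?s * p $$ (i, 0) = b i - ?l * ?x i" using i k by (simp add: p_def)
    moreover have "b' i = 2 * ?l * ?x i - b i" using bb[OF i True] by (simp add: algebra_simps)
    ultimately show ?thesis using i True by (simp add: q_def)
  next
    case False
    thus ?thesis using i det[OF i False] x0[OF i False] by (simp add: p_def q_def field_simps)
  qed
  \<comment> \<open>The unit length of \<open>x + \<epsilon> p\<close> to first order. Moving
    \<open>B\<close> to the other side of the inner product turns \<open>b\<close> into
    \<open>b'\<close>, and then \<open>bb\<close> cancels everything.\<close>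
  have "(\<Sum>i<n. cnj (?x i) * p $$ (i, 0) + cnj (p $$ (i, 0)) * ?x i)
    = (\<Sum>i<n. (cnj (?x i) * b i + cnj (b i) * ?x i - 2 * ?l * cnj (?x i) * ?x i) / ?s)"
    using x0 k by (intro sum.cong) (auto simp: p_def field_simps)
  also have "\<dots> = ((\<Sum>i<n. cnj (?x i) * b i) + (\<Sum>i<n. cnj (b i) * ?x i)
      - (\<Sum>i<n. 2 * ?l * cnj (?x i) * ?x i)) / ?s"
    by (simp only: sum_divide_distrib[symmetric] sum.distrib sum_subtractf)
  also have "(\<Sum>i<n. cnj (b i) * ?x i) = (\<Sum>i<n. \<Sum>j<n. cnj (B $$ (i, j)) * cnj (?x j) * ?x i)"
    by (intro sum.cong) (auto simp: b sum_distrib_right)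
  also have "\<dots> = (\<Sum>j<n. \<Sum>i<n. cnj (B $$ (i, j)) * cnj (?x j) * ?x i)" by (rule sum.swap)
  also have "\<dots> = (\<Sum>j<n. cnj (?x j) * b' j)"
    by (intro sum.cong) (auto simp: b' sum_distrib_left algebra_simps)
  also have "(\<Sum>i<n. cnj (?x i) * b i) + \<dots> = (\<Sum>i<n. cnj (?x i) * (b i + b' i))"
    by (simp add: sum.distrib distrib_left)
  also have "\<dots> = (\<Sum>i<n. 2 * ?l * cnj (?x i) * ?x i)"
    using x0 bb by (intro sum.cong) (auto, metis complex_cnj_zero mult.commute mult_zero_left mult.assoc)
  finally have up: "(\<Sum>i<n. cnj (?x i) * p $$ (i, 0) + cnj (p $$ (i, 0)) * ?x i) = 0" by simp
  \<comment> \<open>The supports of \<open>x\<close> and \<open>q\<close> are disjoint.\<close>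
  have vq: "(\<Sum>i<n. cnj (?x i) * q $$ (i, 0) + cnj (q $$ (i, 0)) * ?x i) = 0"
    using x0 by (intro sum.neutral) (auto simp: q_def)
  have unit: "unit_col n (dual_mat x y)" if "y \<in> carrier_mat n 1"
    "(\<Sum>i<n. cnj (?x i) * y $$ (i, 0) + cnj (y $$ (i, 0)) * ?x i) = 0" for y
    using that xc xs by (simp add: unit_col_iff sum_dual_number times_dual_number_def
      conjugate_dual_number_def one_dual_number_def)
  have "dual_mat ?S B * dual_mat x q = Dual ?s ?l \<cdot>\<^sub>m dual_mat x p"
  proof -
    have "dual_mat ?S B * dual_mat x q = dual_mat (?S * x) (?S * q + B * x)"
      using B xc qc by (intro dual_mat_mult) auto
    also have "\<dots> = dual_mat (?s \<cdot>\<^sub>m x) (?s \<cdot>\<^sub>m p + ?l \<cdot>\<^sub>m x)"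
      using xc pc qc B x0 eq1 
      by (intro dual_mat_cong[of _ n 1]) (auto simp: mat_diag_mult_left[of _ n 1] b_def)
    finally show ?thesis using xc pc by (simp add: dual_mat_smult[of _ n 1])
  qed
  moreover have "adjoint (dual_mat ?S B) * dual_mat x p = Dual ?s ?l \<cdot>\<^sub>m dual_mat x q"
  proof -
    have "adjoint (dual_mat ?S B) = dual_mat ?S (adjoint B)"
      using B by (subst adjoint_dual_mat[of _ n n]) (auto simp: adjoint_mat_diag)
    hence "adjoint (dual_mat ?S B) * dual_mat x p = dual_mat (?S * x) (?S * p + adjoint B * x)"
      using B xc pc by (simp add: dual_mat_mult[of _ n n _ _ 1])
    also have "\<dots> = dual_mat (?s \<cdot>\<^sub>m x) (?s \<cdot>\<^sub>m q + ?l \<cdot>\<^sub>m x)"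
      using xc pc qc B x0 eq2
      by (intro dual_mat_cong[of _ n 1]) (auto simp: mat_diag_mult_left[of _ n 1] b'_def)
    finally show ?thesis using xc qc by (simp add: dual_mat_smult[of _ n 1])
  qed
  ultimately show ?thesis using unit[OF pc up] unit[OF qc vq]
    by (auto simp: singular_pair_def)
qed

lemma dual_complex_of_real_Dual:
  "dual_complex_of_real (Dual a b) = Dual (complex_of_real a) (complex_of_real b)"
  by (simp add: dual_complex_of_real_def)

text \<open>If the standard part is nonzero, it is made diagonal and any positive entry is
  perturbed. Otherwise \<open>A\<close> is \<epsilon> times a complex matrix, and a complex pair of
  that matrix serves, with its value multiplied by \<epsilon>.\<close>

lemma dual_singular_pair:
  fixes A :: "dual_complex mat"
  assumes A: "A \<in> carrier_mat (Suc n) (Suc n)"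
  shows "\<exists>\<sigma> u v. (\<exists>\<nu>\<ge>0. \<sigma> = dual_complex_of_real \<nu>) \<and> singular_pair (Suc n) A \<sigma> u v"
proof -
  let ?n = "Suc n"
  define S where "S = map_mat std_part A"
  define T where "T = map_mat inf_part A"
  have Sc: "S \<in> carrier_mat ?n ?n" and Tc: "T \<in> carrier_mat ?n ?n" using A by (auto simp: S_def T_def)
  have AS: "A = dual_mat S T" by (simp add: S_def T_def dual_mat_parts)
  from complex_svd[OF Sc] obtain P V d where P: "unitary_mat ?n P" and V: "unitary_mat ?n V"
    and d: "\<forall>i<?n. 0 \<le> d i" and SD: "S = P * mat_diag ?n (\<lambda>i. complex_of_real (d i)) * adjoint V" by blast
  note c = unitary_matD(1,2)[OF P] unitary_matD(1,2)[OF V]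
  show ?thesis
  proof (cases "\<exists>k<?n. d k \<noteq> 0")
    case True
    then obtain k where k: "k < ?n" "0 < d k" using d by (auto simp: less_le)
    let ?D = "mat_diag ?n (\<lambda>i. complex_of_real (d i))"
    define B where "B = adjoint P * T * V"
    have Bc: "B \<in> carrier_mat ?n ?n" using c Tc by (simp add: B_def)
    from singular_pair_perturbation[of B ?n d, OF Bc _ k] d obtain l u v where
      p: "singular_pair ?n (dual_mat ?D B) (Dual (complex_of_real (d k)) (complex_of_real l)) u v" by blast
    let ?P = "dual_mat P (0\<^sub>m ?n ?n)" and ?V = "dual_mat V (0\<^sub>m ?n ?n)"
    have "P * B * adjoint V = P * (adjoint P * (T * (V * adjoint V)))"
      using c Tc by (simp add: B_def assoc_mult_mat[of _ ?n ?n _ ?n _ ?n])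
    also have "\<dots> = T" using unitary_mat_cancel(2)[OF P Tc] Tc by (simp add: unitary_matD(3)[OF V])
    finally have "P * B * adjoint V = T" .
    moreover have PD: "P * ?D \<in> carrier_mat ?n ?n" using c(1) mat_diag_dim by (rule mult_carrier_mat)
    ultimately have "?P * dual_mat ?D B * adjoint ?V = A"
      using c Bc Tc right_mult_zero_mat[OF PD, of ?n]
      by (simp add: AS adjoint_dual_mat[of V ?n ?n] dual_mat_mult[of _ ?n ?n _ _ ?n] SD
        mult_carrier_mat[of P ?n ?n _ ?n] left_mult_zero_mat[of _ ?n ?n])
    with singular_pair_unitary[OF unitary_dual_mat_const[OF P] unitary_dual_mat_const[OF V] _ p]
    have "singular_pair ?n A (Dual (complex_of_real (d k)) (complex_of_real l)) (?P * u) (?V * v)"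
      by simp
    \<comment> \<open>The positive standard part decides the order, whatever the sign of
      \<open>l\<close>.\<close>
    moreover have "Dual (d k) l \<ge> 0" using k by (simp add: less_eq_dual_number_def zero_dual_number_def)
    ultimately show ?thesis unfolding dual_complex_of_real_Dual[symmetric] by blast
  next
    case False
    hence "mat_diag ?n (\<lambda>i. complex_of_real (d i)) = 0\<^sub>m ?n ?n"
      by (auto simp: mat_diag_def intro!: eq_matI)
    hence S0: "S = 0\<^sub>m ?n ?n" using c by (simp add: SD)
    from complex_singular_pair[OF Tc] obtain r u v where r: "0 \<le> r"
      and p: "singular_pair ?n T (complex_of_real r) u v" by blast
    have uv: "u \<in> carrier_mat ?n 1" "v \<in> carrier_mat ?n 1"
      using p by (auto simp: singular_pair_def unit_col_def)
    have unit: "unit_col ?n (dual_mat w (0\<^sub>m ?n 1))" if "unit_col ?n w" for w :: "complex mat"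
      using that right_mult_zero_mat[of "adjoint w" 1 ?n 1] left_mult_zero_mat[of w ?n 1 1]
      by (simp add: unit_col_def adjoint_dual_mat[of _ ?n 1] dual_mat_mult[of _ 1 ?n _ _ 1] dual_mat_one[of 1, simplified])
    have "singular_pair ?n A (Dual 0 (complex_of_real r)) (dual_mat u (0\<^sub>m ?n 1)) (dual_mat v (0\<^sub>m ?n 1))"
      unfolding singular_pair_def
    proof (intro conjI)
      show "A * dual_mat v (0\<^sub>m ?n 1) = Dual 0 (complex_of_real r) \<cdot>\<^sub>m dual_mat u (0\<^sub>m ?n 1)"
        using uv p Tc unfolding AS S0
        by (subst dual_mat_mult[of _ ?n ?n _ _ 1])
          (auto simp: dual_mat_smult[of _ ?n 1] singular_pair_def intro!: dual_mat_cong[of _ ?n 1])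
      show "adjoint A * dual_mat u (0\<^sub>m ?n 1) = Dual 0 (complex_of_real r) \<cdot>\<^sub>m dual_mat v (0\<^sub>m ?n 1)"
        using uv p Tc unfolding AS S0
        by (subst adjoint_dual_mat[of _ ?n ?n], simp, simp, subst dual_mat_mult[of _ ?n ?n _ _ 1])
          (auto simp: dual_mat_smult[of _ ?n 1] singular_pair_def intro!: dual_mat_cong[of _ ?n 1])
    qed (use p unit in \<open>auto simp: singular_pair_def\<close>)
    moreover have "Dual 0 r \<ge> 0" using r by (simp add: less_eq_dual_number_def zero_dual_number_def)
    moreover have "dual_complex_of_real (Dual 0 r) = Dual 0 (complex_of_real r)"
      by (simp add: dual_complex_of_real_Dual)
    ultimately show ?thesis by metis
  qed
qed

lemma dual_diagonalization:
  fixes A :: "dual_complex mat"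
  assumes "A \<in> carrier_mat n n"
  shows "\<exists>P V \<nu>. unitary_mat n P \<and> unitary_mat n V \<and> (\<forall>i<n. 0 \<le> \<nu> i) \<and>
    A = P * dual_diag n \<nu> * adjoint V"
proof -
  let ?Q = "\<lambda>\<sigma>. \<exists>\<nu>\<ge>0. \<sigma> = dual_complex_of_real \<nu>"
  have "\<exists>P V d. unitary_mat n P \<and> unitary_mat n V \<and> (\<forall>i<n. ?Q (d i)) \<and>
    A = P * mat_diag n d * adjoint V"
    by (rule unitary_diagonalization[OF dual_unitary_completion dual_singular_pair _ assms])
      (auto simp: dual_complex_of_real_def conjugate_dual_number_def dual_number.map_sel
        intro: dual_number.expand)
  then obtain P V d where PV: "unitary_mat n P" "unitary_mat n V" and d: "\<forall>i<n. ?Q (d i)"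
    and A: "A = P * mat_diag n d * adjoint V" by blast
  from d obtain \<nu> where \<nu>: "\<forall>i<n. 0 \<le> \<nu> i \<and> d i = dual_complex_of_real (\<nu> i)" by metis
  hence "mat_diag n d = dual_diag n \<nu>"
    by (auto simp: mat_diag_def dual_diag_def intro!: eq_matI)
  with A have "A = P * dual_diag n \<nu> * adjoint V" by simp
  thus ?thesis using PV \<nu> by blast
qed

section \<open>The dual singular value decomposition\<close>

lemma permute_antimono:
  fixes \<nu> :: "nat \<Rightarrow> 'a :: linorder"
  shows "\<exists>p. p permutes {..<n} \<and> (\<forall>i j. i \<le> j \<longrightarrow> j < n \<longrightarrow> \<nu> (p j) \<le> \<nu> (p i))"
proof -
  let ?xs = "map \<nu> [0..<n]"
  have "mset (rev (sort ?xs)) = mset ?xs" by simp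
  from mset_eq_permutation[OF this] obtain p
    where p: "p permutes {..<length ?xs}" "permute_list p ?xs = rev (sort ?xs)" by blast
  have nth: "\<nu> (p i) = rev (sort ?xs) ! i" if "i < n" for i
    using permute_list_nth[OF p(1), of i] permutes_in_image[OF p(1), of i] that
    by (simp add: p(2))
  have "\<nu> (p j) \<le> \<nu> (p i)" if "i \<le> j" "j < n" for i j
  proof -
    have "sort ?xs ! (n - Suc j) \<le> sort ?xs ! (n - Suc i)"
      using that by (intro sorted_nth_mono) auto
    thus ?thesis using that by (simp add: nth rev_nth)
  qed
  thus ?thesis using p(1) by auto
qed

lemma mat_diag_permute:
  fixes f :: "nat \<Rightarrow> 'a :: {comm_ring_1, conjugatable_ring}"
  assumes p: "p permutes {..<n}"
  shows "\<exists>R. unitary_mat n R \<and> mat_diag n f = R * mat_diag n (\<lambda>i. f (p i)) * adjoint R"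
proof -
  \<comment> \<open>The permutation matrix whose column \<open>j\<close> is the basis vector with
    index \<open>p j\<close>.\<close>
  define R where "R = mat n n (\<lambda>(i, j). if i = p j then 1 else 0 :: 'a)"
  have Rc: "R \<in> carrier_mat n n" by (simp add: R_def)
  have pn: "p i < n" if "i < n" for i using permutes_in_image[OF p, of i] that by simp
  define q where "q = inv_into UNIV p"
  have pin: "q i < n" if "i < n" for i
    using permutes_in_image[OF permutes_inv[OF p], of i] that by (simp add: q_def)
  have pinj: "p i = p j \<longleftrightarrow> i = j" for i j using permutes_inj[OF p] by (auto dest: injD)
  have iff: "i = p l \<longleftrightarrow> l = q i" for i l using permutes_inv_eq[OF p] by (metis q_def)
  have "adjoint R * R = 1\<^sub>m n"
  proof (rule eq_matI)
    fix i j assume ij: "i < dim_row (1\<^sub>m n :: 'a mat)" "j < dim_col (1\<^sub>m n :: 'a mat)"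
    hence "(adjoint R * R) $$ (i, j)
      = (\<Sum>l<n. (if l = p i then 1 else 0) * (if l = p j then 1 else 0))"
      by (auto simp: R_def scalar_prod_def lessThan_atLeast0 intro!: sum.cong)
    also have "\<dots> = (\<Sum>l<n. if l = p i then if i = j then 1 else 0 else 0)"
      by (intro sum.cong) (auto simp: pinj)
    finally show "(adjoint R * R) $$ (i, j) = 1\<^sub>m n $$ (i, j)" using ij pn by simp
  qed (use Rc in auto)
  moreover have RR: "R * adjoint R = 1\<^sub>m n"
  proof (rule eq_matI)
    fix i j assume ij: "i < dim_row (1\<^sub>m n :: 'a mat)" "j < dim_col (1\<^sub>m n :: 'a mat)"
    hence "(R * adjoint R) $$ (i, j)
      = (\<Sum>l<n. (if i = p l then 1 else 0) * (if j = p l then 1 else 0))"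
      by (auto simp: R_def scalar_prod_def lessThan_atLeast0 intro!: sum.cong)
    also have "\<dots> = (\<Sum>l<n. if l = q i then if i = j then 1 else 0 else 0)"
      by (intro sum.cong) (auto simp: iff[symmetric])
    finally show "(R * adjoint R) $$ (i, j) = 1\<^sub>m n $$ (i, j)" using ij pin by simp
  qed (use Rc in auto)
  ultimately have R: "unitary_mat n R" using Rc by (simp add: unitary_mat_def)
  have "mat_diag n f * R = R * mat_diag n (\<lambda>i. f (p i))"
    unfolding mat_diag_mult_left[OF Rc] mat_diag_mult_right[OF Rc]
    by (rule eq_matI) (auto simp: R_def)
  hence "R * mat_diag n (\<lambda>i. f (p i)) * adjoint R = mat_diag n f * (R * adjoint R)"
    using Rc by (simp add: assoc_mult_mat[of _ n n _ n _ n, symmetric])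
  also have "\<dots> = mat_diag n f" unfolding RR by (rule right_mult_one_mat) (rule mat_diag_dim)
  finally show ?thesis using R by metis
qed

text \<open>Applied to a decreasing sequence of values, this produces both \<open>t\<close> (values
  that are positive) and \<open>r\<close> (values with positive standard part).\<close>

lemma initial_segment_threshold:
  fixes n :: nat
  assumes "\<And>i j. i \<le> j \<Longrightarrow> j < n \<Longrightarrow> Q j \<Longrightarrow> Q i"
  shows "\<exists>r\<le>n. \<forall>i<n. Q i \<longleftrightarrow> i < r"
  using assms
proof (induction n)
  case (Suc n)
  then obtain r where r: "r \<le> n" "\<forall>i<n. Q i \<longleftrightarrow> i < r" by (metis less_SucI)
  show ?case
  proof (cases "Q n")
    case True
    hence "\<forall>i<Suc n. Q i" using Suc.prems by (metis lessI less_Suc_eq_le)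
    thus ?thesis by (intro exI[of _ "Suc n"]) auto
  next
    case False
    thus ?thesis using r by (intro exI[of _ r]) (auto simp: less_Suc_eq)
  qed
qed auto

lemma dual_complex_of_real_zero [simp]: "dual_complex_of_real 0 = 0"
  by (simp add: dual_complex_of_real_def zero_dual_number_def)

text \<open>For square matrices the padded block matrix is again diagonal, so block arithmetic
  disappears from the existence and uniqueness proofs.\<close>

lemma dual_svd_square_iff:
  assumes A: "A \<in> carrier_mat n n"
  shows "dual_svd A P r t \<mu> V \<longleftrightarrow> t \<le> n \<and> unitary_mat n P \<and> unitary_mat n V \<and>
    dual_singular_values r t \<mu> \<and>
    A = P * dual_diag n (\<lambda>i. if i < t then \<mu> i else 0) * adjoint V"
proof -
  have "four_block_mat (dual_diag t \<mu>) (0\<^sub>m t (n - t)) (0\<^sub>m (n - t) t) (0\<^sub>m (n - t) (n - t))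
    = dual_diag n (\<lambda>i. if i < t then \<mu> i else 0)" if "t \<le> n"
    using that by (intro eq_matI) (auto simp: dual_diag_def mat_diag_def)
  thus ?thesis using A by (auto simp: dual_svd_def dual_unitary_iff)
qed

text \<open>The order of dual numbers is lexicographic, so one decreasing sort lists the appreciable
  values first, then the positive infinitesimal ones, then the zeros.\<close>

lemma ex_dual_svd:
  fixes A :: "dual_complex mat"
  assumes A: "A \<in> carrier_mat n n"
  shows "\<exists>P r t \<mu> V. dual_svd A P r t \<mu> V"
proof -
  from dual_diagonalization[OF A] obtain P V \<nu> where P: "unitary_mat n P" and V: "unitary_mat n V"
    and \<nu>: "\<And>i. i < n \<Longrightarrow> 0 \<le> \<nu> i" and AD: "A = P * dual_diag n \<nu> * adjoint V" by blast
  from permute_antimono[of n \<nu>] obtain p where p: "p permutes {..<n}"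
    and le: "\<And>i j. i \<le> j \<Longrightarrow> j < n \<Longrightarrow> \<nu> (p j) \<le> \<nu> (p i)" by blast
  define \<mu> where "\<mu> i = \<nu> (p i)" for i
  have \<mu>: "0 \<le> \<mu> i" if "i < n" for i
    using \<nu>[of "p i"] permutes_in_image[OF p, of i] that by (simp add: \<mu>_def)
  from mat_diag_permute[OF p, of "\<lambda>i. dual_complex_of_real (\<nu> i)"] obtain R where R: "unitary_mat n R"
    and D: "dual_diag n \<nu> = R * dual_diag n \<mu> * adjoint R" by (auto simp: dual_diag_def \<mu>_def)
  note c = unitary_matD(1,2)[OF P] unitary_matD(1,2)[OF V] unitary_matD(1,2)[OF R]
  have Dc: "dual_diag n \<mu> \<in> carrier_mat n n" by (simp add: dual_diag_def)
  have "A = P * R * dual_diag n \<mu> * (adjoint R * adjoint V)"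
    using c Dc by (simp add: AD D assoc_mult_mat[of _ n n _ n _ n])
  also have "adjoint R * adjoint V = adjoint (V * R)" using c by (intro adjoint_mult[symmetric]) auto
  finally have AR: "A = P * R * dual_diag n \<mu> * adjoint (V * R)" .
  have "\<exists>t\<le>n. \<forall>i<n. \<mu> i > 0 \<longleftrightarrow> i < t"
    using le by (intro initial_segment_threshold) (auto simp: \<mu>_def intro: less_le_trans)
  then obtain t where t: "t \<le> n" "\<And>i. i < n \<Longrightarrow> \<mu> i > 0 \<longleftrightarrow> i < t" by blast
  have "\<exists>r\<le>n. \<forall>i<n. std_part (\<mu> i) > 0 \<longleftrightarrow> i < r"
    using le by (intro initial_segment_threshold) (auto simp: \<mu>_def less_eq_dual_number_def, fastforce+)
  then obtain r where r: "r \<le> n" "\<And>i. i < n \<Longrightarrow> std_part (\<mu> i) > 0 \<longleftrightarrow> i < r" by blast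
  have std: "std_part (\<mu> i) \<ge> 0" if "i < n" for i
    using \<mu>[OF that] by (auto simp: less_eq_dual_number_def zero_dual_number_def)
  have "r \<le> t"
  proof (rule ccontr)
    assume "\<not> r \<le> t"
    hence tn: "t < r" "t < n" using r(1) by auto
    hence "\<mu> t > 0" using r(2)[of t] by (simp add: less_dual_number_def zero_dual_number_def)
    thus False using t(2)[of t] tn by simp
  qed
  have "dual_singular_values r t \<mu>"
    unfolding dual_singular_values_def appreciable_def infinitesimal_def
  proof (intro conjI allI impI)
    fix i assume i: "i < r"
    show "std_part (\<mu> i) \<noteq> 0" using r(2)[of i] r(1) i by auto
    show "\<mu> i > 0" using t(2)[of i] t(1) i \<open>r \<le> t\<close> by auto
  next
    fix i assume i: "r \<le> i \<and> i < t"
    show "std_part (\<mu> i) = 0" using r(2)[of i] std[of i] t(1) i by auto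
    show "\<mu> i > 0" using t(2)[of i] t(1) i by auto
  next
    fix i j assume "i \<le> j \<and> j < r"
    thus "\<mu> j \<le> \<mu> i" using le[of i j] r(1) by (simp add: \<mu>_def)
  next
    fix i j assume "r \<le> i \<and> i \<le> j \<and> j < t"
    thus "\<mu> j \<le> \<mu> i" using le[of i j] t(1) by (simp add: \<mu>_def)
  qed fact
  \<comment> \<open>From index \<open>t\<close> on the values are nonnegative and not positive, so
    the padding by zeros changes nothing.\<close>
  moreover have "dual_diag n \<mu> = dual_diag n (\<lambda>i. if i < t then \<mu> i else 0)"
  proof -
    have "\<mu> i = 0" if "i < n" "\<not> i < t" for i
      using \<mu>[OF that(1)] t(2)[OF that(1)] that(2) by (simp add: order_le_less)
    thus ?thesis by (auto simp: dual_diag_def mat_diag_def intro!: eq_matI)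
  qed
  ultimately have "dual_svd A (P * R) r t \<mu> (V * R)"
    using t(1) unitary_mat_mult[OF P R] unitary_mat_mult[OF V R] AR
    unfolding dual_svd_square_iff[OF A] by metis
  thus ?thesis by blast
qed

section \<open>Invariance of the two ranks\<close>

lemma ex_vec_vanishing:
  fixes X :: "complex mat"
  assumes X: "X \<in> carrier_mat n n" and k: "k < k'" "k' \<le> n"
  shows "\<exists>w \<in> carrier_vec n. w \<noteq> 0\<^sub>v n \<and> (\<forall>i<k. w $ i = 0) \<and>
    (\<forall>i. k' \<le> i \<longrightarrow> i < n \<longrightarrow> (X *\<^sub>v w) $ i = 0)"
proof -
  \<comment> \<open>There are \<open>k + (n - k')\<close> linear conditions, fewer than the
    \<open>n\<close> unknowns. Zero rows from \<open>k\<close> to \<open>k' - 1\<close> make the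
    system square, and the zero row \<open>k\<close> rules out a right inverse.\<close>
  define G where "G = mat n n (\<lambda>(i, j). if i < k then if i = j then 1 else 0
    else if i < k' then 0 else X $$ (i, j))"
  have Gc: "G \<in> carrier_mat n n" by (simp add: G_def)
  have "det G = 0"
  proof (rule ccontr)
    assume "det G \<noteq> 0"
    from det_non_zero_imp_unit[OF Gc this, of "()"]
    obtain B where B: "B \<in> carrier_mat n n" "G * B = 1\<^sub>m n"
      by (auto simp: Units_def ring_mat_def)
    have "(G * B) $$ (k, k) = 0"
      using k B(1) Gc by (auto simp: G_def scalar_prod_def)
    thus False using k unfolding B(2) by simp
  qed
  then obtain w where w: "w \<in> carrier_vec n" "w \<noteq> 0\<^sub>v n" and Gw: "G *\<^sub>v w = 0\<^sub>v n"
    using det_0_iff_vec_prod_zero[OF Gc] by blast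
  have "w $ i = 0" if "i < k" for i
  proof -
    have i: "i < n" using that k by simp
    have "(G *\<^sub>v w) $ i = (\<Sum>j\<in>{0..<n}. (if i = j then 1 else 0) * w $ j)"
      using that i w(1) by (auto simp: G_def scalar_prod_def intro!: sum.cong)
    also have "\<dots> = (\<Sum>j\<in>{0..<n}. if j = i then w $ j else 0)"
      by (intro sum.cong) auto
    finally have "(G *\<^sub>v w) $ i = (\<Sum>j\<in>{0..<n}. if j = i then w $ j else 0)" .
    thus ?thesis using i by (simp add: Gw)
  qed
  moreover have "(X *\<^sub>v w) $ i = 0" if "k' \<le> i" "i < n" for i
  proof -
    have "(G *\<^sub>v w) $ i = (X *\<^sub>v w) $ i"
      using that k w(1) X by (auto simp: G_def scalar_prod_def intro!: sum.cong)
    thus ?thesis using that by (simp add: Gw)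
  qed
  ultimately show ?thesis using w by blast
qed

text \<open>Taking standard parts is a ring homomorphism that commutes with conjugation.\<close>

lemma unitary_std_part:
  fixes U :: "dual_complex mat"
  assumes U: "unitary_mat n U"
  shows "unitary_mat n (map_mat std_part U)"
proof -
  define S where "S = map_mat std_part U"
  define T where "T = map_mat inf_part U"
  have Sc: "S \<in> carrier_mat n n" "T \<in> carrier_mat n n"
    using unitary_matD(1)[OF U] by (auto simp: S_def T_def)
  have US: "U = dual_mat S T" by (simp add: S_def T_def dual_mat_parts)
  have std: "map_mat std_part (dual_mat X Y) = X" for X Y :: "complex mat"
    by (rule eq_matI) auto
  have one: "map_mat std_part (1\<^sub>m n :: dual_complex mat) = 1\<^sub>m n"
    by (simp add: std flip: dual_mat_one)
  have "map_mat std_part (U * adjoint U) = S * adjoint S"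
    "map_mat std_part (adjoint U * U) = adjoint S * S"
    using Sc by (simp_all add: US adjoint_dual_mat[of _ n n] dual_mat_mult[of _ n n _ _ n] std)
  thus ?thesis using Sc unitary_matD(3,4)[OF U] by (simp add: unitary_mat_def one S_def[symmetric])
qed

text \<open>The standard parts of the vectors annihilated by \<open>c \<Sigma>\<close>, with \<open>c = 1\<close> or \<open>c = \<epsilon>\<close>, form a
  space whose dimension is invariant under equivalence.\<close>

lemma dual_diag_equivalent_le:
  assumes X: "unitary_mat n X" and Y: "unitary_mat n Y"
    and eq: "dual_diag n \<mu> = Y * dual_diag n \<mu>' * X"
    and k: "k' \<le> n"
    and z: "\<And>i. k \<le> i \<Longrightarrow> i < n \<Longrightarrow> c * dual_complex_of_real (\<mu> i) = 0"
    and nz: "\<And>i. i < k' \<Longrightarrow> c * dual_complex_of_real (\<mu>' i) \<noteq> 0"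
  shows "k' \<le> k"
proof (rule ccontr)
  assume "\<not> k' \<le> k"
  hence kk: "k < k'" by simp
  let ?S = "map_mat std_part X" and ?T = "map_mat inf_part X"
  let ?D = "dual_diag n \<mu>" and ?D' = "dual_diag n \<mu>'"
  note c = unitary_matD(1,2)[OF X] unitary_matD(1,2)[OF Y]
  have D'c: "?D' \<in> carrier_mat n n" by (simp add: dual_diag_def)
  have S: "unitary_mat n ?S" by (rule unitary_std_part[OF X])
  note Sc = unitary_matD(1,2)[OF S]
  \<comment> \<open>If \<open>k < k'\<close>, some nonzero \<open>w\<close> lies in the space
    belonging to \<open>\<mu>\<close>, while its image under the standard part of \<open>X\<close>
    vanishes at all indices from \<open>k'\<close> on.\<close>
  from ex_vec_vanishing[OF Sc(1) kk k] obtain w where w: "w \<in> carrier_vec n" "w \<noteq> 0\<^sub>v n"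
    and wk: "\<forall>i<k. w $ i = 0" and Sw: "\<And>i. k' \<le> i \<Longrightarrow> i < n \<Longrightarrow> (?S *\<^sub>v w) $ i = 0" by blast
  define x where "x = mat n 1 (\<lambda>(i, j). Dual (w $ i) 0)"
  have xc: "x \<in> carrier_mat n 1" by (simp add: x_def)
  have "?D * (c \<cdot>\<^sub>m x) = 0\<^sub>m n 1"
  proof (rule eq_matI)
    fix i j assume ij: "i < dim_row (0\<^sub>m n 1 :: dual_complex mat)" "j < dim_col (0\<^sub>m n 1 :: dual_complex mat)"
    hence "(?D * (c \<cdot>\<^sub>m x)) $$ (i, j) = (c * dual_complex_of_real (\<mu> i)) * Dual (w $ i) 0"
      using xc unfolding dual_diag_def
      by (subst mat_diag_mult_left[of _ n 1]) (auto simp: x_def algebra_simps)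
    moreover have "Dual 0 0 = (0 :: dual_complex)" by (simp add: zero_dual_number_def)
    ultimately show "(?D * (c \<cdot>\<^sub>m x)) $$ (i, j) = 0\<^sub>m n 1 $$ (i, j)"
      using ij z wk by (cases "i < k") auto
  qed (use xc in \<open>auto simp: dual_diag_def mat_diag_def\<close>)
  moreover have "?D' * (c \<cdot>\<^sub>m (X * x)) = adjoint Y * (Y * (?D' * (c \<cdot>\<^sub>m (X * x))))"
    using c xc D'c by (intro unitary_mat_cancel(1)[OF Y, symmetric]) auto
  moreover have "Y * (?D' * (c \<cdot>\<^sub>m (X * x))) = ?D * (c \<cdot>\<^sub>m x)"
    using c xc D'c unfolding eq
    by (simp add: assoc_mult_mat[of _ n n _ n _ n] assoc_mult_mat[of _ n n _ n _ 1]
      mult_smult_distrib[of _ n n _ 1])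
  ultimately have D0: "?D' * (c \<cdot>\<^sub>m (X * x)) = 0\<^sub>m n 1" using c by simp
  have Xx: "std_part ((X * x) $$ (i, 0)) = (?S *\<^sub>v w) $ i" if "i < n" for i
    using that c w(1) by (auto simp: x_def scalar_prod_def sum_dual_number times_dual_number_def)
  \<comment> \<open>The image vanishes below \<open>k'\<close> as well: a nonzero dual number
    annihilates only infinitesimals. As the standard part of \<open>X\<close> is invertible,
    \<open>w\<close> would be zero.\<close>
  have "(?S *\<^sub>v w) $ i = 0" if i: "i < n" for i
  proof (cases "i < k'")
    case True
    have "(?D' * (c \<cdot>\<^sub>m (X * x))) $$ (i, 0) = (c * dual_complex_of_real (\<mu>' i)) * (X * x) $$ (i, 0)"
      using c xc i unfolding dual_diag_def
      by (subst mat_diag_mult_left[of _ n 1]) (auto simp: algebra_simps)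
    hence "(c * dual_complex_of_real (\<mu>' i)) * (X * x) $$ (i, 0) = 0" using i by (simp add: D0)
    hence "std_part ((X * x) $$ (i, 0)) = 0"
      using nz[OF True]
      by (cases "c * dual_complex_of_real (\<mu>' i)")
        (auto simp: times_dual_number_def zero_dual_number_def)
    thus ?thesis by (simp add: Xx[OF i])
  qed (use Sw i in auto)
  hence "?S *\<^sub>v w = 0\<^sub>v n" using Sc by (intro eq_vecI) auto
  hence "adjoint ?S *\<^sub>v (?S *\<^sub>v w) = 0\<^sub>v n" using Sc by auto
  moreover have "adjoint ?S *\<^sub>v (?S *\<^sub>v w) = (adjoint ?S * ?S) *\<^sub>v w"
    using Sc w(1) by (intro assoc_mult_mat_vec[symmetric]) auto
  ultimately show False using w unitary_matD(4)[OF S] by simp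
qed

text \<open>Exchanging the two decompositions gives the reverse inequalities, hence uniqueness of
  \<open>r\<close> and \<open>t\<close>.\<close>

lemma dual_svd_le:
  assumes A: "A \<in> carrier_mat n n" and "dual_svd A P r t \<mu> V" and "dual_svd A P' r' t' \<mu>' V'"
  shows "r' \<le> r" "t' \<le> t"
proof -
  define \<nu> where "\<nu> i = (if i < t then \<mu> i else 0)" for i
  define \<nu>' where "\<nu>' i = (if i < t' then \<mu>' i else 0)" for i
  from assms(2,3) have t: "t \<le> n" "t' \<le> n" and P: "unitary_mat n P" "unitary_mat n P'"
    and V: "unitary_mat n V" "unitary_mat n V'"
    and s: "dual_singular_values r t \<mu>" "dual_singular_values r' t' \<mu>'"
    and eq: "A = P * dual_diag n \<nu> * adjoint V" "A = P' * dual_diag n \<nu>' * adjoint V'"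
    unfolding dual_svd_square_iff[OF A] \<nu>_def[abs_def] \<nu>'_def[abs_def] by blast+
  let ?D = "dual_diag n \<nu>" and ?D' = "dual_diag n \<nu>'"
  note c = unitary_matD(1,2)[OF P(1)] unitary_matD(1,2)[OF P(2)]
    unitary_matD(1,2)[OF V(1)] unitary_matD(1,2)[OF V(2)]
  have D: "?D \<in> carrier_mat n n" "?D' \<in> carrier_mat n n" by (simp_all add: dual_diag_def)
  have "?D = adjoint P * (P * (?D * (adjoint V * V)))"
    using c D unitary_mat_cancel(1)[OF P(1) D(1)] unitary_matD(4)[OF V(1)] by simp
  also have "\<dots> = adjoint P * A * V"
    unfolding eq(1) using c D by (simp add: assoc_mult_mat[of _ n n _ n _ n])
  also have "\<dots> = (adjoint P * P') * ?D' * (adjoint V' * V)"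
    unfolding eq(2) using c D by (simp add: assoc_mult_mat[of _ n n _ n _ n])
  finally have *: "?D = (adjoint P * P') * ?D' * (adjoint V' * V)" .
  have u: "unitary_mat n (adjoint V' * V)" "unitary_mat n (adjoint P * P')"
    using P V by (auto intro!: unitary_mat_mult unitary_mat_adjoint)
  \<comment> \<open>Multiplication by \<epsilon> erases infinitesimal values, so \<epsilon> counts
    the appreciable ones and 1 counts all nonzero ones.\<close>
  have eps: "dual_eps * dual_complex_of_real x = 0 \<longleftrightarrow> std_part x = 0" for x
    by (cases x) (simp add: dual_complex_of_real_def dual_eps_def times_dual_number_def zero_dual_number_def)
  have one: "1 * dual_complex_of_real x = 0 \<longleftrightarrow> x = 0" for x
    by (cases x) (simp add: dual_complex_of_real_def zero_dual_number_def)
  have rt: "r' \<le> t'" "r \<le> t" using s by (auto simp: dual_singular_values_def)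
  show "r' \<le> r"
  proof (rule dual_diag_equivalent_le[OF u * _, where c = dual_eps, unfolded eps])
    show "std_part (\<nu> i) = 0" if "r \<le> i" "i < n" for i
      using s(1) that
      by (auto simp: dual_singular_values_def infinitesimal_def \<nu>_def zero_dual_number_def)
    show "std_part (\<nu>' i) \<noteq> 0" if "i < r'" for i
      using s(2) that rt by (auto simp: dual_singular_values_def appreciable_def \<nu>'_def)
  qed (use t rt in auto)
  show "t' \<le> t"
  proof (rule dual_diag_equivalent_le[OF u * _, where c = 1, unfolded one])
    show "\<nu> i = 0" if "t \<le> i" "i < n" for i
      using that by (simp add: \<nu>_def)
    show "\<nu>' i \<noteq> 0" if "i < t'" for i
    proof -
      have "\<mu>' i > 0" using s(2) that by (cases "i < r'") (auto simp: dual_singular_values_def)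
      thus ?thesis using that by (simp add: \<nu>'_def)
    qed
  qed (use t in auto)
qed

text \<open>Existence and uniqueness together give the definite descriptions their meaning, with one
  decomposition realizing both ranks.\<close>

lemma dual_svd_rank:
  assumes A: "A \<in> carrier_mat n n"
  shows "\<exists>P \<mu> V. dual_svd A P (appreciable_rank A) (dual_rank A) \<mu> V"
proof -
  from ex_dual_svd[OF A] obtain P r t \<mu> V where svd: "dual_svd A P r t \<mu> V" by blast
  have "dual_rank A = t" unfolding dual_rank_def
    using svd dual_svd_le(2)[OF A] by (intro the_equality) (blast intro: antisym)+
  moreover have "appreciable_rank A = r" unfolding appreciable_rank_def
    using svd dual_svd_le(1)[OF A] by (intro the_equality) (blast intro: antisym)+
  ultimately show ?thesis using svd by blast
qed

theorem theorem3p1: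
  fixes A :: "dual_complex mat" and n t r :: nat
  assumes "A \<in> carrier_mat n n"
    and "t = dual_rank A"
    and "r = appreciable_rank A"
  shows "t \<le> n \<and>
    (\<exists>U \<Sigma>\<^sub>0 K\<^sub>0 L\<^sub>0 \<mu>.
       dual_unitary n U \<and>
       K\<^sub>0 \<in> carrier_mat t t \<and>
       L\<^sub>0 \<in> carrier_mat t (n - t) \<and>
       K\<^sub>0 * adjoint K\<^sub>0 + L\<^sub>0 * adjoint L\<^sub>0 = 1\<^sub>m t \<and>
       dual_singular_values r t \<mu> \<and>
       \<Sigma>\<^sub>0 = dual_diag t \<mu> \<and>
       A = U * four_block_mat (\<Sigma>\<^sub>0 * K\<^sub>0) (\<Sigma>\<^sub>0 * L\<^sub>0)
                              (0\<^sub>m (n - t) t) (0\<^sub>m (n - t) (n - t)) * adjoint U)"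
proof -
  note A = assms(1)
  from dual_svd_rank[OF A] obtain P \<mu> V where "dual_svd A P r t \<mu> V"
    unfolding assms(2,3) by blast
  moreover define D where "D = four_block_mat (dual_diag t \<mu>) (0\<^sub>m t (n - t))
    (0\<^sub>m (n - t) t) (0\<^sub>m (n - t) (n - t))"
  ultimately have t: "t \<le> n" and P: "unitary_mat n P" and V: "unitary_mat n V"
    and \<mu>: "dual_singular_values r t \<mu>" and AD: "A = P * D * adjoint V"
    using A by (auto simp: dual_svd_def dual_unitary_iff)
  note c = unitary_matD(1,2)[OF P] unitary_matD(1,2)[OF V]
  have Sc: "dual_diag t \<mu> \<in> carrier_mat t t" by (simp add: dual_diag_def)
  have Dc: "D \<in> carrier_mat n n" unfolding D_def using t Sc by (intro carrier_matI) auto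
  \<comment> \<open>Chosen so that \<open>W P* = V*\<close>; then
    \<open>P D V* = P (D W) P*\<close>.\<close>
  define W where "W = adjoint V * P"
  have W: "unitary_mat n W" unfolding W_def by (intro unitary_mat_mult unitary_mat_adjoint P V)
  note Wc = unitary_matD(1,2)[OF W]
  obtain K L M N where "split_block W t t = (K, L, M, N)" by (metis prod_cases4)
  from split_block[OF this, of "n - t" "n - t"] t Wc
  have KL: "K \<in> carrier_mat t t" "L \<in> carrier_mat t (n - t)" "M \<in> carrier_mat (n - t) t"
    "N \<in> carrier_mat (n - t) (n - t)" and WB: "W = four_block_mat K L M N" by auto
  \<comment> \<open>The zero rows of \<open>D\<close> remove the lower blocks \<open>M\<close> and
    \<open>N\<close>, and its diagonal block scales the upper ones.\<close>
  have DW: "D * W = four_block_mat (dual_diag t \<mu> * K) (dual_diag t \<mu> * L)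
    (0\<^sub>m (n - t) t) (0\<^sub>m (n - t) (n - t))"
    unfolding D_def WB using KL Sc left_mult_zero_mat[OF KL(3)] left_mult_zero_mat[OF KL(4)]
      left_mult_zero_mat[OF KL(1)] left_mult_zero_mat[OF KL(2)]
      mult_carrier_mat[OF Sc KL(1)] mult_carrier_mat[OF Sc KL(2)]
    by (subst mult_four_block_mat[of _ t t _ "n - t" _ "n - t" _ _ t _ "n - t"]) auto
  \<comment> \<open>The upper left block of \<open>W W* = 1\<close>.\<close>
  have "K * adjoint K + L * adjoint L = 1\<^sub>m t"
  proof (rule eq_matI)
    fix i j assume "i < dim_row (1\<^sub>m t :: dual_complex mat)" "j < dim_col (1\<^sub>m t :: dual_complex mat)"
    hence ij: "i < t" "j < t" by auto
    have "W * adjoint W = four_block_mat (K * adjoint K + L * adjoint L) (K * adjoint M + L * adjoint N)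
      (M * adjoint K + N * adjoint L) (M * adjoint M + N * adjoint N)"
      unfolding WB using KL
      by (simp add: adjoint_four_block_mat[of _ t t _ "n - t" _ "n - t"]
        mult_four_block_mat[of _ t t _ "n - t" _ "n - t" _ _ t _ "n - t"])
    from arg_cong[OF this, of "\<lambda>B. B $$ (i, j)"]
    show "(K * adjoint K + L * adjoint L) $$ (i, j) = 1\<^sub>m t $$ (i, j)"
      using ij t KL by (simp add: unitary_matD(3)[OF W])
  qed (use KL in auto)
  moreover have "A = P * (D * W) * adjoint P"
  proof -
    have "W * adjoint P = adjoint V"
      using c by (simp add: W_def assoc_mult_mat[of _ n n _ n _ n] unitary_matD(3)[OF P])
    thus ?thesis using c Dc Wc by (simp add: AD assoc_mult_mat[of _ n n _ n _ n])
  qed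
  ultimately show ?thesis
    using t P KL \<mu> unfolding DW dual_unitary_iff by blast
qed

end
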